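(* Let $\lambda,\mu,\nu$ be partitions of $n\in\mathbb{N}$, all different from $(n)$ and $(1^n)$. Then the Kronecker product $[\lambda]\cdot[\mu]\cdot[\nu]$ of the irreducible characters $[\lambda],[\mu],[\nu]$ of $\mathfrak{S}_n$ is not multiplicity-free.
   Context: For a partition $\lambda$ of $n$, $[\lambda]$ denotes the irreducible complex character of the symmetric group $\mathfrak{S}_n$ labelled by $\lambda$. The Kronecker product is the pointwise (inner tensor) product of characters. A character of $\mathfrak{S}_n$ is multiplicity-free if each irreducible character occurs in it with multiplicity at most $1$. *)

theory Defs
  imports
    "HOL-Algebra.Sym_Groups"
    "HOL-Library.Function_Algebras"
    "Jordan_Normal_Form.VS_Connect"
begin

section \<open>Complex characters of a group\<close>

definition mat_trace :: "complex mat \<Rightarrow> complex"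
  where "mat_trace A = (\<Sum>i<dim_row A. A $$ (i, i))"

text \<open>A matrix representation of degree \<open>d\<close> is a homomorphism into
  $GL_d(\mathbf{C})$, the group of units of the ring of complex \<open>d \<times> d\<close> matrices.\<close>

definition representation_of ::
    "('g, 'm) monoid_scheme \<Rightarrow> nat \<Rightarrow> ('g \<Rightarrow> complex mat) \<Rightarrow> bool"
  where "representation_of G d \<rho> \<longleftrightarrow>
    \<rho> \<in> hom G (units_of (ring_mat TYPE(complex) d ()))"

definition irreducible_representation ::
    "('g, 'm) monoid_scheme \<Rightarrow> nat \<Rightarrow> ('g \<Rightarrow> complex mat) \<Rightarrow> bool"
  where "irreducible_representation G d \<rho> \<longleftrightarrow>
    representation_of G d \<rho> \<and> d > 0 \<and>
    (\<forall>W. VectorSpace.subspace class_ring W (module_vec TYPE(complex) d) \<and>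
         (\<forall>g\<in>carrier G. \<forall>w\<in>W. \<rho> g *\<^sub>v w \<in> W)
       \<longrightarrow> W = {0\<^sub>v d} \<or> W = carrier_vec d)"

text \<open>Characters are restricted to the carrier of the group, so that two of them are equal
  as HOL functions iff they agree on the group.\<close>

definition irreducible_characters :: "('g, 'm) monoid_scheme \<Rightarrow> ('g \<Rightarrow> complex) set"
  where "irreducible_characters G =
    {restrict (\<lambda>g. mat_trace (\<rho> g)) (carrier G) | d \<rho>. irreducible_representation G d \<rho>}"

text \<open>The decomposition of a character of a finite group into irreducible characters, recorded
  as a multiset, is unique; the multiplicity of a constituent is its \<open>count\<close>.\<close>

definition decomposes_into ::
    "('g, 'm) monoid_scheme \<Rightarrow> ('g \<Rightarrow> complex) \<Rightarrow> ('g \<Rightarrow> complex) multiset \<Rightarrow> bool"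
  where "decomposes_into G \<chi> M \<longleftrightarrow>
    set_mset M \<subseteq> irreducible_characters G \<and>
    (\<forall>g\<in>carrier G. \<chi> g = (\<Sum>\<psi>\<in>#M. \<psi> g))"

definition multiplicity_free ::
    "('g, 'm) monoid_scheme \<Rightarrow> ('g \<Rightarrow> complex) \<Rightarrow> bool"
  where "multiplicity_free G \<chi> \<longleftrightarrow>
    (\<exists>M. decomposes_into G \<chi> M \<and> (\<forall>\<psi>\<in>irreducible_characters G. count M \<psi> \<le> 1))"


section \<open>Traces on spaces of complex functions\<close>

definition cfun_scale :: "complex \<Rightarrow> ('a \<Rightarrow> complex) \<Rightarrow> 'a \<Rightarrow> complex"
  where "cfun_scale c v = (\<lambda>x. c * v x)"

interpretation cfun: vector_space "cfun_scale :: complex \<Rightarrow> ('a \<Rightarrow> complex) \<Rightarrow> 'a \<Rightarrow> complex"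
  by unfold_locales (auto simp: cfun_scale_def algebra_simps)

text \<open>Trace of a linear map \<open>f\<close> on a finite-dimensional, \<open>f\<close>-invariant subspace \<open>V\<close>;
  \<open>cfun.representation B v b\<close> is the coefficient of \<open>b\<close> in the expansion of \<open>v\<close> in
  the basis \<open>B\<close>.\<close>

definition trace_on ::
    "('a \<Rightarrow> complex) set \<Rightarrow> (('a \<Rightarrow> complex) \<Rightarrow> ('a \<Rightarrow> complex)) \<Rightarrow> complex"
  where "trace_on V f =
    (let B = (SOME B. \<not> cfun.dependent B \<and> cfun.span B = V)
     in \<Sum>b\<in>B. cfun.representation B (f b) b)"


section \<open>Specht modules and their characters\<close>

definition partition_of :: "nat \<Rightarrow> nat list \<Rightarrow> bool"
  where "partition_of n \<alpha> \<longleftrightarrow> sorted_wrt (\<ge>) \<alpha> \<and> (\<forall>k\<in>set \<alpha>. k > 0) \<and> sum_list \<alpha> = n"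

definition young_diagram :: "nat list \<Rightarrow> (nat \<times> nat) set"
  where "young_diagram \<alpha> = {(i, j). i < length \<alpha> \<and> j < \<alpha> ! i}"

definition tableaux :: "nat list \<Rightarrow> (nat \<times> nat \<Rightarrow> nat) set"
  where "tableaux \<alpha> = {t. bij_betw t (young_diagram \<alpha>) {1..sum_list \<alpha>}}"

definition row_entries :: "nat list \<Rightarrow> (nat \<times> nat \<Rightarrow> nat) \<Rightarrow> nat \<Rightarrow> nat set"
  where "row_entries \<alpha> t i = t ` {c \<in> young_diagram \<alpha>. fst c = i}"

definition column_entries :: "nat list \<Rightarrow> (nat \<times> nat \<Rightarrow> nat) \<Rightarrow> nat \<Rightarrow> nat set"
  where "column_entries \<alpha> t j = t ` {c \<in> young_diagram \<alpha>. snd c = j}"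

definition column_stabilizer :: "nat list \<Rightarrow> (nat \<times> nat \<Rightarrow> nat) \<Rightarrow> (nat \<Rightarrow> nat) set"
  where "column_stabilizer \<alpha> t =
    {\<pi>. \<pi> permutes {1..sum_list \<alpha>} \<and>
        (\<forall>j. \<pi> ` column_entries \<alpha> t j = column_entries \<alpha> t j)}"

text \<open>The tabloid \<open>{t}\<close> is encoded as the sequence \<open>row_entries \<alpha> t\<close> of the sets of entries of its
  rows. An element of the permutation module spanned by the tabloids is encoded as its
  coefficient function. The polytabloid of \<open>t\<close> is the sum of \<open>sign \<pi> \<cdot> {\<pi> \<circ> t}\<close>
  over the column stabilizer of \<open>t\<close>.\<close>

definition polytabloid ::
    "nat list \<Rightarrow> (nat \<times> nat \<Rightarrow> nat) \<Rightarrow> (nat \<Rightarrow> nat set) \<Rightarrow> complex"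
  where "polytabloid \<alpha> t = (\<lambda>T. \<Sum>\<pi>\<in>column_stabilizer \<alpha> t.
    of_int (sign \<pi>) * (if T = row_entries \<alpha> (\<pi> \<circ> t) then 1 else 0))"

definition specht_module :: "nat list \<Rightarrow> ((nat \<Rightarrow> nat set) \<Rightarrow> complex) set"
  where "specht_module \<alpha> = cfun.span (polytabloid \<alpha> ` tableaux \<alpha>)"

text \<open>The linear action of a permutation \<open>g\<close>, determined by \<open>g \<cdot> {t} = {g \<circ> t}\<close>.\<close>

definition tabloid_action ::
    "(nat \<Rightarrow> nat) \<Rightarrow> ((nat \<Rightarrow> nat set) \<Rightarrow> complex) \<Rightarrow> (nat \<Rightarrow> nat set) \<Rightarrow> complex"
  where "tabloid_action g v = (\<lambda>T. v (\<lambda>i. inv' g ` T i))"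

text \<open>The irreducible character \<open>[\<alpha>]\<close> of the symmetric group of degree \<open>sum_list \<alpha>\<close>, with the
  convention that \<open>[(n)]\<close> is the trivial and \<open>[(1\<^sup>n)]\<close> the sign character.\<close>

definition sym_character :: "nat list \<Rightarrow> (nat \<Rightarrow> nat) \<Rightarrow> complex"
  where "sym_character \<alpha> g = trace_on (specht_module \<alpha>) (tabloid_action g)"

end

theory Submission
  imports Defs "Jordan_Normal_Form.Spectral_Radius"
begin

text \<open>
  If \<open>[\<alpha>] \<cdot> [\<beta>] \<cdot> [\<gamma>]\<close> is multiplicity-free, the endomorphisms of the tensor product
  \<open>A \<otimes> B \<otimes> C\<close> of the Specht modules commute. Commuting the endomorphisms
  \<open>\<Sum>\<^sub>\<tau> \<tau> \<otimes> \<tau> \<otimes> 1\<close> and \<open>\<Sum>\<^sub>\<sigma> \<sigma> \<otimes> 1 \<otimes> \<sigma>\<close>, summed over all transpositions, and applying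
  linear functionals to \<open>B\<close> and \<open>C\<close> shows that \<open>\<Sum>\<^sub>\<tau> f(\<tau>) \<tau>\<close> and \<open>\<Sum>\<^sub>\<sigma> g(\<sigma>) \<sigma>\<close> commute
  on \<open>A\<close> whenever \<open>f\<close> and \<open>g\<close> are restrictions to the transpositions of matrix coefficients of \<open>B\<close> and \<open>C\<close>.

  If \<open>n \<ge> 4\<close> and \<open>\<beta>\<close> is neither \<open>(n)\<close> nor \<open>(1\<^sup>n)\<close>, such \<open>f\<close> include all alternating \<open>4\<close>-cycles
  \<open>(a b) + (c d) - (b c) - (d a)\<close>; if moreover \<open>\<beta>\<close> is a hook (and \<open>n \<ge> 3\<close>), they include all differences
  \<open>(a b) - (a c)\<close>. If some factor, say \<open>\<alpha>\<close>, is not a hook, then its diagram contains a \<open>2 \<times> 2\<close>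
  block, and two alternating \<open>4\<close>-cycles on the entries of the block do not commute on the polytabloid. If
  all three are hooks, the same happens for \<open>(u x) - (u y)\<close> and \<open>(x u) - (x y)\<close>, where \<open>u\<close>, \<open>x\<close>, \<open>y\<close> are
  the entries of the corner, its right and its lower neighbour.
\<close>

section \<open>Idempotent matrices\<close>

text \<open>Matrices are functions of two indices from an arbitrary set, of which only the entries
  on \<open>I\<close> matter. Bases of Specht modules and products of such bases can then serve as
  index sets without being enumerated.\<close>

definition trace_fun :: "'i set \<Rightarrow> ('i \<Rightarrow> 'i \<Rightarrow> complex) \<Rightarrow> complex"
  where "trace_fun I A = (\<Sum>i\<in>I. A i i)"

definition mult_fun ::
    "'i set \<Rightarrow> ('i \<Rightarrow> 'i \<Rightarrow> complex) \<Rightarrow> ('i \<Rightarrow> 'i \<Rightarrow> complex) \<Rightarrow> 'i \<Rightarrow> 'i \<Rightarrow> complex"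
  where "mult_fun I A B = (\<lambda>i j. \<Sum>k\<in>I. A i k * B k j)"

lemma mult_fun_assoc: "mult_fun I (mult_fun I A B) C = mult_fun I A (mult_fun I B C)"
proof (intro ext)
  fix i j
  have "(\<Sum>k\<in>I. (\<Sum>l\<in>I. A i l * B l k) * C k j) = (\<Sum>k\<in>I. \<Sum>l\<in>I. A i l * B l k * C k j)"
    by (simp add: sum_distrib_right)
  also have "\<dots> = (\<Sum>l\<in>I. \<Sum>k\<in>I. A i l * B l k * C k j)"
    by (rule sum.swap)
  also have "\<dots> = (\<Sum>l\<in>I. A i l * (\<Sum>k\<in>I. B l k * C k j))"
    by (simp add: sum_distrib_left mult.assoc)
  finally show "mult_fun I (mult_fun I A B) C i j = mult_fun I A (mult_fun I B C) i j"
    by (simp add: mult_fun_def)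
qed

lemma mult_fun_cong:
  assumes "\<And>i j. i \<in> I \<Longrightarrow> j \<in> I \<Longrightarrow> A i j = A' i j"
    and "\<And>i j. i \<in> I \<Longrightarrow> j \<in> I \<Longrightarrow> B i j = B' i j"
    and "i \<in> I" "j \<in> I"
  shows "mult_fun I A B i j = mult_fun I A' B' i j"
  using assms by (simp add: mult_fun_def)

text \<open>Splitting off the rank-one idempotent given by a nonzero column and a nonzero row of \<open>Q\<close>
  lowers the trace by one and leaves fewer nonzero rows.\<close>

lemma idempotent_trace:
  fixes Q :: "'i \<Rightarrow> 'i \<Rightarrow> complex"
  assumes "finite I"
    and "\<And>i j. i \<in> I \<Longrightarrow> j \<in> I \<Longrightarrow> mult_fun I Q Q i j = Q i j"
  shows "\<exists>m::nat. trace_fun I Q = of_nat m \<and>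
    (m = 0 \<longrightarrow> (\<forall>i\<in>I. \<forall>j\<in>I. Q i j = 0)) \<and>
    (m = 1 \<longrightarrow> (\<exists>y z. \<forall>i\<in>I. \<forall>j\<in>I. Q i j = y i * z j))"
  using assms(2)
proof (induction "card {i\<in>I. \<exists>j\<in>I. Q i j \<noteq> 0}" arbitrary: Q rule: less_induct)
  case less
  show ?case
  proof (cases "\<forall>i\<in>I. \<forall>j\<in>I. Q i j = 0")
    case True
    then show ?thesis
      by (intro exI[of _ 0]) (simp add: trace_fun_def)
  next
    case False
    then obtain p q where pq: "p \<in> I" "q \<in> I" "Q p q \<noteq> 0"
      by blast
    define y where "y i = Q i q" for i
    define z where "z j = Q p j / Q p q" for j
    define Q' where "Q' i j = Q i j - y i * z j" for i j
    have idem: "(\<Sum>k\<in>I. Q i k * Q k j) = Q i j" if "i \<in> I" "j \<in> I" for i j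
      using less.prems[OF that] by (simp add: mult_fun_def)
    have zy: "(\<Sum>k\<in>I. z k * y k) = 1"
      using idem[OF pq(1,2)] pq(3)
      by (simp add: y_def z_def sum_divide_distrib[symmetric])
    have Qy: "(\<Sum>k\<in>I. Q i k * y k) = y i" if "i \<in> I" for i
      using idem[OF that pq(2)] by (simp add: y_def)
    have zQ: "(\<Sum>k\<in>I. z k * Q k j) = z j" if "j \<in> I" for j
      using idem[OF pq(1) that] by (simp add: z_def sum_divide_distrib[symmetric])
    have idem': "mult_fun I Q' Q' i j = Q' i j" if ij: "i \<in> I" "j \<in> I" for i j
    proof -
      have "mult_fun I Q' Q' i j = (\<Sum>k\<in>I. Q i k * Q k j) - (\<Sum>k\<in>I. Q i k * y k) * z j
          - y i * (\<Sum>k\<in>I. z k * Q k j) + y i * (\<Sum>k\<in>I. z k * y k) * z j"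
        by (simp add: mult_fun_def Q'_def sum_distrib_left sum_distrib_right sum_subtractf
            sum.distrib algebra_simps)
      then show ?thesis
        by (simp add: zy Qy zQ ij idem Q'_def)
    qed
    \<comment> \<open>A zero row of \<open>Q\<close> has \<open>y i = 0\<close>, so subtracting
      \<open>y i * z j\<close> keeps it zero. Row \<open>p\<close> becomes zero because
      \<open>z\<close> is normalised by \<open>Q p q\<close>.\<close>
    have sub: "{i\<in>I. \<exists>j\<in>I. Q' i j \<noteq> 0} \<subseteq> {i\<in>I. \<exists>j\<in>I. Q i j \<noteq> 0}"
      using pq(2) by (auto simp: Q'_def y_def) (metis mult_zero_left)
    have "p \<in> {i\<in>I. \<exists>j\<in>I. Q i j \<noteq> 0}" "p \<notin> {i\<in>I. \<exists>j\<in>I. Q' i j \<noteq> 0}"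
      using pq by (auto simp: Q'_def y_def z_def)
    then have "{i\<in>I. \<exists>j\<in>I. Q' i j \<noteq> 0} \<subset> {i\<in>I. \<exists>j\<in>I. Q i j \<noteq> 0}"
      using sub by blast
    then have "card {i\<in>I. \<exists>j\<in>I. Q' i j \<noteq> 0} < card {i\<in>I. \<exists>j\<in>I. Q i j \<noteq> 0}"
      using assms(1) by (intro psubset_card_mono) auto
    from less.hyps[OF this idem'] obtain m :: nat where m: "trace_fun I Q' = of_nat m"
      "m = 0 \<longrightarrow> (\<forall>i\<in>I. \<forall>j\<in>I. Q' i j = 0)"
      by blast
    have "trace_fun I Q' = trace_fun I Q - (\<Sum>k\<in>I. z k * y k)"
      by (simp add: trace_fun_def Q'_def sum_subtractf mult.commute)
    then have "trace_fun I Q = of_nat (Suc m)"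
      using m(1) zy by simp
    \<comment> \<open>If \<open>Q\<close> has trace one, the remainder \<open>Q'\<close> has trace
      zero and vanishes by the induction hypothesis, which leaves the column \<open>y\<close> times
      the row \<open>z\<close>.\<close>
    moreover have "\<exists>y z. \<forall>i\<in>I. \<forall>j\<in>I. Q i j = y i * z j" if "Suc m = 1"
      using m(2) that by (intro exI[of _ y] exI[of _ z]) (simp add: Q'_def)
    ultimately show ?thesis
      by (intro exI[of _ "Suc m"]) auto
  qed
qed

text \<open>The \<open>Q x\<close> add up to the identity because the complementary idempotent has trace \<open>0\<close>,
  and they are simultaneous eigenprojections of \<open>S\<close> and \<open>T\<close> because they have rank one.\<close>

lemma commute_of_trace_one_idempotents:
  fixes Q :: "'x \<Rightarrow> 'i \<Rightarrow> 'i \<Rightarrow> complex"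
  assumes I: "finite I" and X: "finite X" "card X = card I"
    and Q: "\<And>x y i j. x \<in> X \<Longrightarrow> y \<in> X \<Longrightarrow> i \<in> I \<Longrightarrow> j \<in> I \<Longrightarrow>
      mult_fun I (Q x) (Q y) i j = (if x = y then Q x i j else 0)"
    and tr: "\<And>x. x \<in> X \<Longrightarrow> trace_fun I (Q x) = 1"
    and S: "\<And>x i j. x \<in> X \<Longrightarrow> i \<in> I \<Longrightarrow> j \<in> I \<Longrightarrow> mult_fun I S (Q x) i j = mult_fun I (Q x) S i j"
    and T: "\<And>x i j. x \<in> X \<Longrightarrow> i \<in> I \<Longrightarrow> j \<in> I \<Longrightarrow> mult_fun I T (Q x) i j = mult_fun I (Q x) T i j"
    and ij: "i \<in> I" "j \<in> I"
  shows "mult_fun I S T i j = mult_fun I T S i j"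
proof -
  define E where "E i j = (\<Sum>x\<in>X. Q x i j)" for i j
  define F where "F i j = (if i = j then 1 else 0) - E i j" for i j
  have EE: "mult_fun I E E i j = E i j" if "i \<in> I" "j \<in> I" for i j
  proof -
    have "mult_fun I E E i j = (\<Sum>k\<in>I. \<Sum>x\<in>X. \<Sum>y\<in>X. Q x i k * Q y k j)"
      by (simp add: mult_fun_def E_def sum_product)
    also have "\<dots> = (\<Sum>x\<in>X. \<Sum>y\<in>X. mult_fun I (Q x) (Q y) i j)"
      by (simp add: mult_fun_def sum.swap[of _ X I])
    also have "\<dots> = (\<Sum>x\<in>X. \<Sum>y\<in>X. if x = y then Q x i j else 0)"
      using Q that by (intro sum.cong refl) auto
    also have "\<dots> = E i j"
      using X(1) by (simp add: E_def)
    finally show ?thesis .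
  qed
  have FF: "mult_fun I F F i j = F i j" if "i \<in> I" "j \<in> I" for i j
  proof -
    have "mult_fun I F F i j = (\<Sum>k\<in>I. (if i = k then 1 else 0) * (if k = j then 1 else 0))
        - (\<Sum>k\<in>I. (if i = k then 1 else 0) * E k j)
        - (\<Sum>k\<in>I. E i k * (if k = j then 1 else 0)) + mult_fun I E E i j"
      by (simp add: mult_fun_def F_def sum_subtractf sum.distrib algebra_simps)
    moreover have "(\<Sum>k\<in>I. (if i = k then 1 else 0) * (if k = j then 1 else 0))
        = (if i = j then 1 else (0::complex))"
      using I that by (subst sum.mono_neutral_right[where S="{i}"]) auto
    moreover have "(\<Sum>k\<in>I. (if i = k then 1 else 0) * E k j) = E i j"
      using I that by (subst sum.mono_neutral_right[where S="{i}"]) auto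
    moreover have "(\<Sum>k\<in>I. E i k * (if k = j then 1 else 0)) = E i j"
      using I that by (subst sum.mono_neutral_right[where S="{j}"]) auto
    ultimately show ?thesis
      using EE[OF that] by (simp add: F_def)
  qed
  have "trace_fun I F = of_nat (card I) - (\<Sum>i\<in>I. \<Sum>x\<in>X. Q x i i)"
    by (simp add: trace_fun_def F_def E_def sum_subtractf)
  also have "(\<Sum>i\<in>I. \<Sum>x\<in>X. Q x i i) = (\<Sum>x\<in>X. trace_fun I (Q x))"
    by (simp add: trace_fun_def sum.swap[of _ X I])
  also have "\<dots> = of_nat (card I)"
    using tr X by simp
  finally have "trace_fun I F = 0"
    by simp
  then have "F i j = 0" if "i \<in> I" "j \<in> I" for i j
    using idempotent_trace[OF I, of F] FF that by auto
  then have E: "E i j = (if i = j then 1 else 0)" if "i \<in> I" "j \<in> I" for i j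
    using that by (fastforce simp: F_def)
  \<comment> \<open>As \<open>S\<close> commutes with the idempotent \<open>Q x\<close>, the product
    \<open>S Q\<close> equals \<open>Q S Q\<close>. Writing \<open>Q\<close> as column
    \<open>y\<close> times row \<open>z\<close> turns the middle into the scalar
    \<open>z S y\<close>.\<close>
  have eig: "\<exists>s. \<forall>i\<in>I. \<forall>j\<in>I. mult_fun I S (Q x) i j = s * Q x i j"
    if x: "x \<in> X" and S: "\<And>i j. i \<in> I \<Longrightarrow> j \<in> I \<Longrightarrow> mult_fun I S (Q x) i j = mult_fun I (Q x) S i j"
    for x S
  proof -
    obtain y z where yz: "Q x i j = y i * z j" if "i \<in> I" "j \<in> I" for i j
      using idempotent_trace[OF I, of "Q x"] Q[OF x x] tr[OF x] by auto
    have "mult_fun I S (Q x) i j = (\<Sum>k\<in>I. \<Sum>l\<in>I. z k * S k l * y l) * Q x i j"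
      if ij: "i \<in> I" "j \<in> I" for i j
    proof -
      have "mult_fun I S (Q x) i j = mult_fun I S (mult_fun I (Q x) (Q x)) i j"
        by (rule mult_fun_cong) (use Q[OF x x] ij in auto)
      also have "\<dots> = mult_fun I (mult_fun I S (Q x)) (Q x) i j"
        by (simp add: mult_fun_assoc)
      also have "\<dots> = mult_fun I (mult_fun I (Q x) S) (Q x) i j"
        by (rule mult_fun_cong) (use S ij in auto)
      also have "\<dots> = mult_fun I (Q x) (mult_fun I S (Q x)) i j"
        by (simp add: mult_fun_assoc)
      also have "\<dots> = (\<Sum>k\<in>I. y i * z k * (\<Sum>l\<in>I. S k l * (y l * z j)))"
        using yz ij by (simp add: mult_fun_def)
      also have "\<dots> = (\<Sum>k\<in>I. \<Sum>l\<in>I. z k * S k l * y l) * (y i * z j)"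
        by (simp add: sum_distrib_left sum_distrib_right algebra_simps)
      finally show ?thesis
        using yz ij by simp
    qed
    then show ?thesis
      by blast
  qed
  have "\<exists>s. \<forall>x\<in>X. \<forall>i\<in>I. \<forall>j\<in>I. mult_fun I S (Q x) i j = s x * Q x i j"
    by (intro bchoice ballI eig S)
  then obtain s where s: "\<And>x i j. x \<in> X \<Longrightarrow> i \<in> I \<Longrightarrow> j \<in> I \<Longrightarrow> mult_fun I S (Q x) i j = s x * Q x i j"
    by blast
  have "\<exists>t. \<forall>x\<in>X. \<forall>i\<in>I. \<forall>j\<in>I. mult_fun I T (Q x) i j = t x * Q x i j"
    by (intro bchoice ballI eig T)
  then obtain t where t: "\<And>x i j. x \<in> X \<Longrightarrow> i \<in> I \<Longrightarrow> j \<in> I \<Longrightarrow> mult_fun I T (Q x) i j = t x * Q x i j"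
    by blast
  \<comment> \<open>Multiplying \<open>A B\<close> on the right by the identity \<open>E\<close>,
    the sum of all \<open>Q x\<close>, gives an expression symmetric in the eigenvalues of
    \<open>A\<close> and \<open>B\<close>.\<close>
  have expand: "mult_fun I A B i j = (\<Sum>x\<in>X. b x * (a x * Q x i j))"
    if ij: "i \<in> I" "j \<in> I"
      and a: "\<And>x i j. x \<in> X \<Longrightarrow> i \<in> I \<Longrightarrow> j \<in> I \<Longrightarrow> mult_fun I A (Q x) i j = a x * Q x i j"
      and b: "\<And>x i j. x \<in> X \<Longrightarrow> i \<in> I \<Longrightarrow> j \<in> I \<Longrightarrow> mult_fun I B (Q x) i j = b x * Q x i j"
    for A B a b i j
  proof -
    have "mult_fun I A B i j = mult_fun I (mult_fun I A B) E i j"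
      unfolding mult_fun_def[of I "mult_fun I A B"]
      using E ij I by (subst sum.mono_neutral_right[where S="{j}"]) auto
    also have "\<dots> = (\<Sum>x\<in>X. mult_fun I (mult_fun I A B) (Q x) i j)"
      by (simp add: mult_fun_def[of I "mult_fun I A B"] E_def sum_distrib_left sum.swap[of _ X I])
    also have "\<dots> = (\<Sum>x\<in>X. b x * (a x * Q x i j))"
    proof (rule sum.cong)
      fix x assume x: "x \<in> X"
      have "mult_fun I (mult_fun I A B) (Q x) i j = mult_fun I A (\<lambda>i j. b x * Q x i j) i j"
        unfolding mult_fun_assoc by (rule mult_fun_cong) (use b x ij in auto)
      also have "\<dots> = b x * mult_fun I A (Q x) i j"
        by (simp add: mult_fun_def sum_distrib_left algebra_simps)
      finally show "mult_fun I (mult_fun I A B) (Q x) i j = b x * (a x * Q x i j)"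
        using a x ij by simp
    qed simp
    finally show ?thesis .
  qed
  show ?thesis
    using expand[OF ij s t] expand[OF ij t s] by (simp add: algebra_simps)
qed

section \<open>Schur orthogonality\<close>

lemma mult_mat_entry:
  assumes "A \<in> carrier_mat l m" "B \<in> carrier_mat m n" "i < l" "j < n"
  shows "(A * B) $$ (i, j) = (\<Sum>k<m. A $$ (i, k) * B $$ (k, j))"
  using assms by (simp add: scalar_prod_def lessThan_atLeast0)

lemma mat_trace_mult_commute:
  assumes "A \<in> carrier_mat m n" "B \<in> carrier_mat n m"
  shows "mat_trace (A * B) = mat_trace (B * A)"
proof -
  have "mat_trace (A * B) = (\<Sum>i<m. \<Sum>k<n. A $$ (i, k) * B $$ (k, i))"
    unfolding mat_trace_def using assms by (intro sum.cong) (auto simp: mult_mat_entry[OF assms] simp del: index_mult_mat(1))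
  also have "\<dots> = (\<Sum>k<n. \<Sum>i<m. B $$ (k, i) * A $$ (i, k))"
    by (subst sum.swap) (simp add: mult.commute)
  also have "\<dots> = mat_trace (B * A)"
    unfolding mat_trace_def using assms
    by (intro sum.cong) (auto simp: mult_mat_entry[OF assms(2,1)] simp del: index_mult_mat(1))
  finally show ?thesis .
qed

lemma subspace_vecI:
  assumes "W \<subseteq> carrier_vec d" "0\<^sub>v d \<in> W"
    and "\<And>v w. v \<in> W \<Longrightarrow> w \<in> W \<Longrightarrow> v + w \<in> W"
    and "\<And>c v. v \<in> W \<Longrightarrow> c \<cdot>\<^sub>v v \<in> W"
  shows "VectorSpace.subspace class_ring W (module_vec TYPE(complex) d)"
proof (rule VectorSpace.subspace.intro[OF vec_vs], rule submodule.intro[OF vec_module])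
qed (use assms in \<open>auto simp: module_vec_simps class_ring_simps\<close>)

lemma mat_entry_eq_unit_vec:
  assumes "(M :: complex mat) \<in> carrier_mat m n" "i < m" "j < n"
  shows "M $$ (i, j) = (M *\<^sub>v unit_vec n j) $ i"
  using assms by simp

lemma mat_eq_zero_if_annihilates:
  assumes M: "(M :: complex mat) \<in> carrier_mat m n"
    and "\<And>v. v \<in> carrier_vec n \<Longrightarrow> M *\<^sub>v v = 0\<^sub>v m"
  shows "M = 0\<^sub>m m n"
proof (rule eq_matI)
  fix i j assume ij: "i < dim_row (0\<^sub>m m n)" "j < dim_col (0\<^sub>m m n)"
  then have "M $$ (i, j) = (M *\<^sub>v unit_vec n j) $ i"
    using M by (intro mat_entry_eq_unit_vec) auto
  also have "\<dots> = 0\<^sub>m m n $$ (i, j)"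
    using assms(2)[of "unit_vec n j"] ij by simp
  finally show "M $$ (i, j) = 0\<^sub>m m n $$ (i, j)" .
qed (use M in auto)

context group
begin

lemma representation_ofD:
  assumes "representation_of G d D"
  shows "g \<in> carrier G \<Longrightarrow> D g \<in> carrier_mat d d"
    and "g \<in> carrier G \<Longrightarrow> h \<in> carrier G \<Longrightarrow> D (g \<otimes> h) = D g * D h"
    and "D \<one> = 1\<^sub>m d"
proof -
  let ?R = "ring_mat TYPE(complex) d ()"
  interpret R: ring ?R
    by (rule ring_mat)
  have hom: "D \<in> hom G (units_of ?R)"
    using assms by (simp add: representation_of_def)
  show "D g \<in> carrier_mat d d" if "g \<in> carrier G"
    using hom_in_carrier[OF hom that] by (simp add: units_of_def Units_def ring_mat_simps)
  show "D (g \<otimes> h) = D g * D h" if "g \<in> carrier G" "h \<in> carrier G"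
    using hom_mult[OF hom that] by (simp add: units_of_def ring_mat_simps)
  show "D \<one> = 1\<^sub>m d"
    using hom_one[OF hom is_group R.units_group] by (simp add: units_of_def ring_mat_simps)
qed

lemma irreducible_representationD:
  assumes "irreducible_representation G d D"
  shows "representation_of G d D" "d > 0"
    and "W \<subseteq> carrier_vec d \<Longrightarrow> 0\<^sub>v d \<in> W \<Longrightarrow> (\<And>v w. v \<in> W \<Longrightarrow> w \<in> W \<Longrightarrow> v + w \<in> W) \<Longrightarrow>
      (\<And>c v. v \<in> W \<Longrightarrow> c \<cdot>\<^sub>v v \<in> W) \<Longrightarrow> (\<And>g w. g \<in> carrier G \<Longrightarrow> w \<in> W \<Longrightarrow> D g *\<^sub>v w \<in> W) \<Longrightarrow>
      W = {0\<^sub>v d} \<or> W = carrier_vec d"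
  using assms subspace_vecI[of W d] unfolding irreducible_representation_def by blast+

text \<open>The kernel is a subspace invariant under \<open>D\<close>, to which irreducibility
  applies. Both forms of Schur's lemma below start from this dichotomy.\<close>

lemma intertwiner_kernel:
  assumes irr: "irreducible_representation G d D" and rep: "representation_of G d' D'"
    and M: "M \<in> carrier_mat d' d"
    and MD: "\<And>g. g \<in> carrier G \<Longrightarrow> M * D g = D' g * M"
  shows "{v \<in> carrier_vec d. M *\<^sub>v v = 0\<^sub>v d'} = {0\<^sub>v d} \<or>
    {v \<in> carrier_vec d. M *\<^sub>v v = 0\<^sub>v d'} = carrier_vec d"
proof (rule irreducible_representationD(3)[OF irr])
  show "0\<^sub>v d \<in> {v \<in> carrier_vec d. M *\<^sub>v v = 0\<^sub>v d'}"
    using M by auto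
  show "v + w \<in> {v \<in> carrier_vec d. M *\<^sub>v v = 0\<^sub>v d'}"
    if "v \<in> {v \<in> carrier_vec d. M *\<^sub>v v = 0\<^sub>v d'}" "w \<in> {v \<in> carrier_vec d. M *\<^sub>v v = 0\<^sub>v d'}" for v w
    using that by (simp add: mult_add_distrib_mat_vec[OF M])
  show "c \<cdot>\<^sub>v v \<in> {v \<in> carrier_vec d. M *\<^sub>v v = 0\<^sub>v d'}"
    if "v \<in> {v \<in> carrier_vec d. M *\<^sub>v v = 0\<^sub>v d'}" for c v
    using that by (auto simp: mult_mat_vec[OF M] intro!: eq_vecI)
  show "D g *\<^sub>v w \<in> {v \<in> carrier_vec d. M *\<^sub>v v = 0\<^sub>v d'}"
    if g: "g \<in> carrier G" and "w \<in> {v \<in> carrier_vec d. M *\<^sub>v v = 0\<^sub>v d'}" for g w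
  proof -
    have w: "w \<in> carrier_vec d" "M *\<^sub>v w = 0\<^sub>v d'"
      using that(2) by auto
    note D = representation_ofD(1)[OF irreducible_representationD(1)[OF irr] g]
    note D' = representation_ofD(1)[OF rep g]
    have "M *\<^sub>v (D g *\<^sub>v w) = D' g *\<^sub>v (M *\<^sub>v w)"
      using assoc_mult_mat_vec[OF M D w(1)] assoc_mult_mat_vec[OF D' M w(1)] MD[OF g] by simp
    also have "\<dots> = 0\<^sub>v d'"
      using D' w by auto
    finally show ?thesis
      using D w by auto
  qed
qed auto

text \<open>Schur's lemma for different characters. By irreducibility a nonzero intertwiner has zero
  kernel and full image, so it is invertible and conjugates \<open>D\<close> into \<open>D'\<close>,
  which forces equal traces.\<close>

lemma schur_distinct:
  assumes irr: "irreducible_representation G d D" and irr': "irreducible_representation G d' D'"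
    and M: "M \<in> carrier_mat d' d"
    and MD: "\<And>g. g \<in> carrier G \<Longrightarrow> M * D g = D' g * M"
    and ne: "g0 \<in> carrier G" "mat_trace (D g0) \<noteq> mat_trace (D' g0)"
  shows "M = 0\<^sub>m d' d"
proof (rule ccontr)
  assume "M \<noteq> 0\<^sub>m d' d"
  note rep = irreducible_representationD(1)[OF irr]
  note rep' = irreducible_representationD(1)[OF irr']
  have ker: "{v \<in> carrier_vec d. M *\<^sub>v v = 0\<^sub>v d'} = {0\<^sub>v d}"
    using intertwiner_kernel[OF irr rep' M MD] mat_eq_zero_if_annihilates[OF M] \<open>M \<noteq> 0\<^sub>m d' d\<close> by blast
  have "(\<lambda>v. M *\<^sub>v v) ` carrier_vec d = {0\<^sub>v d'} \<or> (\<lambda>v. M *\<^sub>v v) ` carrier_vec d = carrier_vec d'"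
  proof (rule irreducible_representationD(3)[OF irr'])
    show "(\<lambda>v. M *\<^sub>v v) ` carrier_vec d \<subseteq> carrier_vec d'"
      using M by auto
    have "M *\<^sub>v 0\<^sub>v d = 0\<^sub>v d'"
      using M by auto
    then show "0\<^sub>v d' \<in> (\<lambda>v. M *\<^sub>v v) ` carrier_vec d"
      by (intro image_eqI[of _ _ "0\<^sub>v d"]) auto
    show "v + w \<in> (\<lambda>v. M *\<^sub>v v) ` carrier_vec d"
      if "v \<in> (\<lambda>v. M *\<^sub>v v) ` carrier_vec d" "w \<in> (\<lambda>v. M *\<^sub>v v) ` carrier_vec d" for v w
      using that by (auto simp: mult_add_distrib_mat_vec[OF M, symmetric])
    show "c \<cdot>\<^sub>v v \<in> (\<lambda>v. M *\<^sub>v v) ` carrier_vec d"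
      if "v \<in> (\<lambda>v. M *\<^sub>v v) ` carrier_vec d" for c v
      using that by (auto simp: mult_mat_vec[OF M, symmetric])
    show "D' g *\<^sub>v w \<in> (\<lambda>v. M *\<^sub>v v) ` carrier_vec d"
      if g: "g \<in> carrier G" and w: "w \<in> (\<lambda>v. M *\<^sub>v v) ` carrier_vec d" for g w
    proof -
      obtain v where v: "v \<in> carrier_vec d" "w = M *\<^sub>v v"
        using w by auto
      note D = representation_ofD(1)[OF rep g]
      note D' = representation_ofD(1)[OF rep' g]
      have "D' g *\<^sub>v w = M *\<^sub>v (D g *\<^sub>v v)"
        using assoc_mult_mat_vec[OF M D v(1)] assoc_mult_mat_vec[OF D' M v(1)] MD[OF g] v by simp
      then show ?thesis
        using D v by auto
    qed
  qed
  moreover have "(\<lambda>v. M *\<^sub>v v) ` carrier_vec d \<noteq> {0\<^sub>v d'}"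
    using mat_eq_zero_if_annihilates[OF M] \<open>M \<noteq> 0\<^sub>m d' d\<close> by blast
  ultimately have "(\<lambda>v. M *\<^sub>v v) ` carrier_vec d = carrier_vec d'"
    by blast
  \<comment> \<open>Preimages of the unit vectors form the columns of a right inverse
    \<open>N\<close>. It is also a left inverse by injectivity, since \<open>M\<close> annihilates
    \<open>N M v - v\<close>.\<close>
  then have "\<forall>i. \<exists>v. v \<in> carrier_vec d \<and> unit_vec d' i = M *\<^sub>v v"
    by (metis (no_types, lifting) imageE unit_vec_carrier)
  then obtain f where f: "\<And>i. f i \<in> carrier_vec d" "\<And>i. unit_vec d' i = M *\<^sub>v f i"
    by metis
  define N where "N = mat d d' (\<lambda>(i, j). f j $ i)"
  have N: "N \<in> carrier_mat d d'"
    by (simp add: N_def)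
  have colN: "col N j = f j" if "j < d'" for j
    using that f(1)[of j] by (intro eq_vecI) (auto simp: N_def)
  have MN: "M * N = 1\<^sub>m d'"
  proof (rule eq_matI)
    fix i j assume ij: "i < dim_row (1\<^sub>m d')" "j < dim_col (1\<^sub>m d')"
    then have "(M * N) $$ (i, j) = (M *\<^sub>v f j) $ i"
      using M N colN by simp
    then show "(M * N) $$ (i, j) = 1\<^sub>m d' $$ (i, j)"
      unfolding f(2)[of j, symmetric] using ij by (simp add: unit_vec_def)
  qed (use M N in auto)
  have NM: "N * M = 1\<^sub>m d"
  proof -
    have *: "N *\<^sub>v (M *\<^sub>v v) = v" if v: "v \<in> carrier_vec d" for v
    proof -
      have NMv: "N *\<^sub>v (M *\<^sub>v v) \<in> carrier_vec d"
        using N M v by simp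
      have "M *\<^sub>v (N *\<^sub>v (M *\<^sub>v v)) = (M * N) *\<^sub>v (M *\<^sub>v v)"
        using M N v by (intro assoc_mult_mat_vec[symmetric]) auto
      also have "\<dots> = M *\<^sub>v v"
        using M v by (simp add: MN)
      finally have "M *\<^sub>v (N *\<^sub>v (M *\<^sub>v v) - v) = 0\<^sub>v d'"
        using M v NMv by (simp add: mult_minus_distrib_mat_vec[OF M NMv v])
      then have "N *\<^sub>v (M *\<^sub>v v) - v \<in> {v \<in> carrier_vec d. M *\<^sub>v v = 0\<^sub>v d'}"
        using NMv v by simp
      then have "N *\<^sub>v (M *\<^sub>v v) - v = 0\<^sub>v d"
        unfolding ker by simp
      then have "\<forall>i<d. (N *\<^sub>v (M *\<^sub>v v) - v) $ i = 0"
        by simp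
      then show ?thesis
        using NMv v N by (intro eq_vecI) auto
    qed
    show ?thesis
    proof (rule eq_matI)
      fix i j assume ij: "i < dim_row (1\<^sub>m d)" "j < dim_col (1\<^sub>m d)"
      then have "(N * M) $$ (i, j) = ((N * M) *\<^sub>v unit_vec d j) $ i"
        using M N by (intro mat_entry_eq_unit_vec) auto
      also have "(N * M) *\<^sub>v unit_vec d j = N *\<^sub>v (M *\<^sub>v unit_vec d j)"
        by (rule assoc_mult_mat_vec[OF N M]) simp
      also have "\<dots> $ i = 1\<^sub>m d $$ (i, j)"
        using ij by (subst *) (auto simp: unit_vec_def)
      finally show "(N * M) $$ (i, j) = 1\<^sub>m d $$ (i, j)" .
    qed (use M N in auto)
  qed
  note D = representation_ofD(1)[OF rep ne(1)]
  note D' = representation_ofD(1)[OF rep' ne(1)]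
  have "D' g0 = (D' g0 * M) * N"
    using D' M N MN by simp
  also have "\<dots> = M * (D g0 * N)"
    using M D N by (simp add: MD[OF ne(1), symmetric])
  finally have "mat_trace (D' g0) = mat_trace (D g0 * N * M)"
    using mat_trace_mult_commute[OF M, of "D g0 * N"] D N by simp
  also have "D g0 * N * M = D g0"
    using D M N NM by simp
  finally show False
    using ne(2) by simp
qed

text \<open>Schur's lemma over the complex numbers. \<open>M\<close> has an eigenvalue
  \<open>c\<close>, and \<open>M - c\<close> still commutes with the representation but has a
  nonzero kernel, so its kernel is the whole space.\<close>

lemma schur_scalar:
  assumes irr: "irreducible_representation G d D"
    and M: "M \<in> carrier_mat d d"
    and MD: "\<And>g. g \<in> carrier G \<Longrightarrow> M * D g = D g * M"
  shows "\<exists>c. M = c \<cdot>\<^sub>m 1\<^sub>m d"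
proof -
  note rep = irreducible_representationD(1)[OF irr]
  obtain c where "eigenvalue M c"
    using spectrum_non_empty[OF M irreducible_representationD(2)[OF irr]] by (auto simp: spectrum_def)
  then obtain v where v: "v \<in> carrier_vec d" "v \<noteq> 0\<^sub>v d" "M *\<^sub>v v = c \<cdot>\<^sub>v v"
    using M by (auto simp: eigenvalue_def eigenvector_def)
  define L where "L = M - c \<cdot>\<^sub>m 1\<^sub>m d"
  have L: "L \<in> carrier_mat d d"
    using M by (simp add: L_def minus_carrier_mat)
  have "L *\<^sub>v v = M *\<^sub>v v - (c \<cdot>\<^sub>m 1\<^sub>m d) *\<^sub>v v"
    unfolding L_def using M v by (intro minus_mult_distrib_mat_vec) auto
  also have "(c \<cdot>\<^sub>m 1\<^sub>m d) *\<^sub>v v = c \<cdot>\<^sub>v v"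
    proof (rule eq_vecI)
    fix i assume "i < dim_vec (c \<cdot>\<^sub>v v)"
    then have "i < d"
      using v by simp
    then have "((c \<cdot>\<^sub>m 1\<^sub>m d) *\<^sub>v v) $ i = (\<Sum>k = 0..<d. c * (if k = i then 1 else 0) * v $ k)"
      using v by (auto simp: scalar_prod_def)
    also have "\<dots> = (\<Sum>k = 0..<d. if k = i then c * v $ k else 0)"
      by (intro sum.cong) auto
    also have "\<dots> = c * v $ i"
      using \<open>i < d\<close> by simp
    finally show "((c \<cdot>\<^sub>m 1\<^sub>m d) *\<^sub>v v) $ i = (c \<cdot>\<^sub>v v) $ i"
      using \<open>i < d\<close> v by simp
  qed (use v in simp)
  also have "M *\<^sub>v v - c \<cdot>\<^sub>v v = 0\<^sub>v d"
    using v by simp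
  finally have Lv: "L *\<^sub>v v = 0\<^sub>v d" .
  have LD: "L * D g = D g * L" if g: "g \<in> carrier G" for g
  proof -
    note D = representation_ofD(1)[OF rep g]
    have "L * D g = M * D g - (c \<cdot>\<^sub>m 1\<^sub>m d) * D g"
      unfolding L_def using M D by (intro minus_mult_distrib_mat) auto
    moreover have "D g * L = D g * M - D g * (c \<cdot>\<^sub>m 1\<^sub>m d)"
      unfolding L_def using M D by (intro mult_minus_distrib_mat) auto
    moreover have "(c \<cdot>\<^sub>m 1\<^sub>m d) * D g = c \<cdot>\<^sub>m D g" "D g * (c \<cdot>\<^sub>m 1\<^sub>m d) = c \<cdot>\<^sub>m D g"
      using D by (simp_all add: mult_smult_assoc_mat[of _ d d _ d] mult_smult_distrib[of _ d d _ d])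
    ultimately show ?thesis
      using MD[OF g] by simp
  qed
  have "{v \<in> carrier_vec d. L *\<^sub>v v = 0\<^sub>v d} = carrier_vec d"
    using intertwiner_kernel[OF irr rep L LD] Lv v by blast
  then have "L = 0\<^sub>m d d"
    by (intro mat_eq_zero_if_annihilates L) blast
  have "M $$ (i, j) = (c \<cdot>\<^sub>m 1\<^sub>m d) $$ (i, j)" if "i < d" "j < d" for i j
  proof -
    have "L $$ (i, j) = M $$ (i, j) - (c \<cdot>\<^sub>m 1\<^sub>m d) $$ (i, j)"
      unfolding L_def using M that by (intro index_minus_mat) auto
    then show ?thesis
      using \<open>L = 0\<^sub>m d d\<close> that by simp
  qed
  then have "M = c \<cdot>\<^sub>m 1\<^sub>m d"
    using M by (intro eq_matI) auto
  then show ?thesis ..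
qed

text \<open>\<open>M\<close> is the sum over the group of \<open>D' h * E * D (inv h)\<close>, where
  \<open>E\<close> is the matrix unit at \<open>(b, c)\<close>. Reindexing the sum by left
  multiplication with \<open>g\<close> moves \<open>g\<close> from one side to the other.\<close>

lemma representation_average_intertwines:
  assumes rep: "representation_of G d D" and rep': "representation_of G d' D'"
    and bc: "b < d'" "c < d" and g: "g \<in> carrier G"
  defines "M \<equiv> mat d' d (\<lambda>(a, e). \<Sum>h\<in>carrier G. D' h $$ (a, b) * D (inv h) $$ (c, e))"
  shows "M * D g = D' g * M"
proof (rule eq_matI)
  note D = representation_ofD(1)[OF rep] and D' = representation_ofD(1)[OF rep']
  note Dm = representation_ofD(2)[OF rep] and Dm' = representation_ofD(2)[OF rep']
  have M: "M \<in> carrier_mat d' d"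
    by (simp add: M_def)
  fix a f assume "a < dim_row (D' g * M)" "f < dim_col (D' g * M)"
  then have af: "a < d'" "f < d"
    using M D'[OF g] by auto
  have "(M * D g) $$ (a, f) = (\<Sum>e<d. M $$ (a, e) * D g $$ (e, f))"
    by (rule mult_mat_entry[OF M D[OF g] af])
  also have "\<dots> = (\<Sum>e<d. \<Sum>h\<in>carrier G. D' h $$ (a, b) * (D (inv h) $$ (c, e) * D g $$ (e, f)))"
    using af by (simp add: M_def sum_distrib_right mult.assoc)
  also have "\<dots> = (\<Sum>h\<in>carrier G. D' h $$ (a, b) * (\<Sum>e<d. D (inv h) $$ (c, e) * D g $$ (e, f)))"
    by (subst sum.swap) (simp add: sum_distrib_left)
  also have "\<dots> = (\<Sum>h\<in>carrier G. D' h $$ (a, b) * D (inv h \<otimes> g) $$ (c, f))"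
    using af bc g by (intro sum.cong refl) (simp add: Dm mult_mat_entry[OF D D])
  also have "\<dots> = (\<Sum>h\<in>carrier G. D' (g \<otimes> h) $$ (a, b) * D (inv h) $$ (c, f))"
  proof (rule sum.reindex_bij_witness[of _ "\<lambda>h. g \<otimes> h" "\<lambda>h. inv g \<otimes> h"])
    fix h assume h: "h \<in> carrier G"
    show "g \<otimes> (inv g \<otimes> h) = h" "inv g \<otimes> (g \<otimes> h) = h"
      using g h by (simp_all add: m_assoc[symmetric])
    show "inv g \<otimes> h \<in> carrier G" "g \<otimes> h \<in> carrier G"
      using g h by simp_all
    show "D' (g \<otimes> (inv g \<otimes> h)) $$ (a, b) * D (inv (inv g \<otimes> h)) $$ (c, f)
        = D' h $$ (a, b) * D (inv h \<otimes> g) $$ (c, f)"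
      using g h by (simp add: m_assoc[symmetric] inv_mult_group)
  qed
  also have "\<dots> = (\<Sum>h\<in>carrier G. (\<Sum>e<d'. D' g $$ (a, e) * D' h $$ (e, b)) * D (inv h) $$ (c, f))"
    using af bc g by (intro sum.cong refl) (simp add: Dm' mult_mat_entry[OF D' D'])
  also have "\<dots> = (\<Sum>e<d'. \<Sum>h\<in>carrier G. D' g $$ (a, e) * (D' h $$ (e, b) * D (inv h) $$ (c, f)))"
    by (subst sum.swap) (simp add: sum_distrib_right mult.assoc)
  also have "\<dots> = (\<Sum>e<d'. D' g $$ (a, e) * M $$ (e, f))"
    using af by (simp add: M_def sum_distrib_left)
  also have "\<dots> = (D' g * M) $$ (a, f)"
    by (rule mult_mat_entry[OF D'[OF g] M af, symmetric])
  finally show "(M * D g) $$ (a, f) = (D' g * M) $$ (a, f)" .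
qed (use representation_ofD(1)[OF rep g] representation_ofD(1)[OF rep' g] in \<open>simp_all add: M_def\<close>)

lemma schur_orthogonality_distinct:
  assumes irr: "irreducible_representation G d D" and irr': "irreducible_representation G d' D'"
    and ne: "g0 \<in> carrier G" "mat_trace (D g0) \<noteq> mat_trace (D' g0)"
    and idx: "a < d'" "b < d'" "c < d" "e < d"
  shows "(\<Sum>h\<in>carrier G. D' h $$ (a, b) * D (inv h) $$ (c, e)) = 0"
proof -
  note rep = irreducible_representationD(1)[OF irr] irreducible_representationD(1)[OF irr']
  let ?M = "mat d' d (\<lambda>(a, e). \<Sum>h\<in>carrier G. D' h $$ (a, b) * D (inv h) $$ (c, e))"
  have "?M = 0\<^sub>m d' d"
    by (rule schur_distinct[OF irr irr' _ representation_average_intertwines[OF rep idx(2,3)] ne]) auto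
  then have "?M $$ (a, e) = 0\<^sub>m d' d $$ (a, e)"
    by (rule arg_cong)
  then show ?thesis
    using idx by simp
qed

text \<open>By Schur's lemma the summed matrix is a scalar \<open>m\<close>. Its trace
  \<open>d * m\<close> is computed by multiplying in the opposite order, where each \<open>h\<close>
  contributes the \<open>(c, b)\<close> entry of the identity matrix.\<close>

lemma schur_orthogonality_same:
  assumes irr: "irreducible_representation G d D"
    and idx: "a < d" "b < d" "c < d" "e < d"
  shows "(\<Sum>h\<in>carrier G. D h $$ (a, b) * D (inv h) $$ (c, e)) =
    (if a = e \<and> b = c then of_nat (card (carrier G)) / of_nat d else 0)"
proof -
  note rep = irreducible_representationD(1)[OF irr]
  note D = representation_ofD(1)[OF rep]
  let ?M = "mat d d (\<lambda>(a, e). \<Sum>h\<in>carrier G. D h $$ (a, b) * D (inv h) $$ (c, e))"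
  obtain m where m: "?M = m \<cdot>\<^sub>m 1\<^sub>m d"
    using schur_scalar[OF irr _ representation_average_intertwines[OF rep rep idx(2,3)]] by auto
  have m: "(\<Sum>h\<in>carrier G. D h $$ (i, b) * D (inv h) $$ (c, j)) = (if i = j then m else 0)"
    if "i < d" "j < d" for i j
    proof -
    have "?M $$ (i, j) = (m \<cdot>\<^sub>m 1\<^sub>m d) $$ (i, j)"
      by (simp only: m)
    then show ?thesis
      using that by (cases "i = j") auto
  qed
  have "of_nat d * m = (\<Sum>i<d. \<Sum>h\<in>carrier G. D h $$ (i, b) * D (inv h) $$ (c, i))"
    by (simp add: m)
  also have "\<dots> = (\<Sum>h\<in>carrier G. \<Sum>i<d. D (inv h) $$ (c, i) * D h $$ (i, b))"
    by (subst sum.swap) (simp add: mult.commute)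
  also have "\<dots> = (\<Sum>h\<in>carrier G. D (inv h \<otimes> h) $$ (c, b))"
    using idx
    by (intro sum.cong refl, subst representation_ofD(2)[OF rep]) (simp_all add: mult_mat_entry[OF D D] del: index_mult_mat(1))
  also have "\<dots> = of_nat (card (carrier G)) * (if b = c then 1 else 0)"
    using idx by (simp add: representation_ofD(3)[OF rep])
  finally have "m = of_nat (card (carrier G)) * (if b = c then 1 else 0) / of_nat d"
    using irreducible_representationD(2)[OF irr] by (simp add: field_simps)
  then show ?thesis
    using m[OF idx(1,4)] by auto
qed

end

section \<open>Endomorphisms of multiplicity-free representations\<close>

text \<open>Schur orthogonality makes the operators \<open>Q\<close> below pairwise orthogonal
  idempotents. Multiplicity one gives each of them trace one, and their number, the sum of the
  degrees, is the value of \<chi> at the identity, which is \<open>card I\<close>. This yields a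
  rank-one splitting of the identity matrix without constructing irreducible subspaces.\<close>

lemma (in group) commute_of_multiplicity_free:
  fixes R :: "'a \<Rightarrow> 'i \<Rightarrow> 'i \<Rightarrow> complex"
  assumes G: "finite (carrier G)" and I: "finite I"
    and R_one: "\<And>i j. i \<in> I \<Longrightarrow> j \<in> I \<Longrightarrow> R \<one> i j = (if i = j then 1 else 0)"
    and R_mult: "\<And>g h i j. g \<in> carrier G \<Longrightarrow> h \<in> carrier G \<Longrightarrow> i \<in> I \<Longrightarrow> j \<in> I \<Longrightarrow>
      mult_fun I (R g) (R h) i j = R (g \<otimes> h) i j"
    and \<chi>: "\<And>g. g \<in> carrier G \<Longrightarrow> \<chi> g = trace_fun I (R g)"
    and mf: "multiplicity_free G \<chi>"
    and S: "\<And>g i j. g \<in> carrier G \<Longrightarrow> i \<in> I \<Longrightarrow> j \<in> I \<Longrightarrow> mult_fun I S (R g) i j = mult_fun I (R g) S i j"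
    and T: "\<And>g i j. g \<in> carrier G \<Longrightarrow> i \<in> I \<Longrightarrow> j \<in> I \<Longrightarrow> mult_fun I T (R g) i j = mult_fun I (R g) T i j"
    and ij: "i \<in> I" "j \<in> I"
  shows "mult_fun I S T i j = mult_fun I T S i j"
proof -
  obtain M where M: "set_mset M \<subseteq> irreducible_characters G"
      "\<And>g. g \<in> carrier G \<Longrightarrow> \<chi> g = (\<Sum>\<psi>\<in>#M. \<psi> g)"
      "\<And>\<psi>. \<psi> \<in> irreducible_characters G \<Longrightarrow> count M \<psi> \<le> 1"
    using mf unfolding multiplicity_free_def decomposes_into_def by blast
  define \<Psi> where "\<Psi> = set_mset M"
  have fin\<Psi>: "finite \<Psi>"
    by (simp add: \<Psi>_def)
  \<comment> \<open>All multiplicities are 0 or 1, so \<open>M\<close> comes from a set of distinct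
    characters and \<chi> is a plain sum over it.\<close>
  have "count M \<psi> = count (mset_set \<Psi>) \<psi>" for \<psi>
  proof (cases "\<psi> \<in> \<Psi>")
    case True
    then have "count M \<psi> \<le> 1" "count M \<psi> > 0"
      using M(1,3) by (auto simp: \<Psi>_def)
    then have "count M \<psi> = 1"
      by linarith
    then show ?thesis
      using True fin\<Psi> by simp
  next
    case False
    then show ?thesis
      using fin\<Psi> by (simp add: \<Psi>_def not_in_iff)
  qed
  then have "M = mset_set \<Psi>"
    by (rule multiset_eqI)
  then have \<chi>_sum: "\<chi> g = (\<Sum>\<psi>\<in>\<Psi>. \<psi> g)" if "g \<in> carrier G" for g
    using M(2)[OF that] by (simp add: sum_unfold_sum_mset)
  have "\<forall>\<psi>\<in>\<Psi>. \<exists>dD. irreducible_representation G (fst dD) (snd dD) \<and>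
      \<psi> = restrict (\<lambda>g. mat_trace (snd dD g)) (carrier G)"
    using M(1) unfolding \<Psi>_def irreducible_characters_def by fastforce
  then obtain dD where dD: "\<And>\<psi>. \<psi> \<in> \<Psi> \<Longrightarrow> irreducible_representation G (fst (dD \<psi>)) (snd (dD \<psi>))"
      "\<And>\<psi>. \<psi> \<in> \<Psi> \<Longrightarrow> \<psi> = restrict (\<lambda>g. mat_trace (snd (dD \<psi>) g)) (carrier G)"
    using bchoice[of \<Psi> "\<lambda>\<psi> dD. irreducible_representation G (fst dD) (snd dD) \<and>
      \<psi> = restrict (\<lambda>g. mat_trace (snd dD g)) (carrier G)"] by blast
  define d where "d \<psi> = fst (dD \<psi>)" for \<psi>
  define D where "D \<psi> = snd (dD \<psi>)" for \<psi>
  have irr: "irreducible_representation G (d \<psi>) (D \<psi>)" if "\<psi> \<in> \<Psi>" for \<psi>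
    using dD(1)[OF that] by (simp add: d_def D_def)
  note rep = irreducible_representationD(1)[OF irr]
  note D = representation_ofD(1)[OF rep]
  have tr: "\<psi> g = mat_trace (D \<psi> g)" if "\<psi> \<in> \<Psi>" "g \<in> carrier G" for \<psi> g
    using fun_cong[OF dD(2)[OF that(1)], of g] that(2) by (simp add: D_def)
  have tr_sum: "\<psi> g = (\<Sum>b<d \<psi>. D \<psi> g $$ (b, b))" if "\<psi> \<in> \<Psi>" "g \<in> carrier G" for \<psi> g
    using tr[OF that] D[OF that] by (simp add: mat_trace_def)
  have \<chi>_sum_sum: "\<chi> g = (\<Sum>\<psi>\<in>\<Psi>. \<Sum>b<d \<psi>. D \<psi> g $$ (b, b))" if "g \<in> carrier G" for g
    unfolding \<chi>_sum[OF that] by (intro sum.cong refl tr_sum that)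
  have d_pos: "d \<psi> > 0" if "\<psi> \<in> \<Psi>" for \<psi>
    by (rule irreducible_representationD(2)[OF irr[OF that]])
  have orth: "(\<Sum>h\<in>carrier G. D \<phi> h $$ (a, b) * D \<psi> (inv h) $$ (c, e)) =
      (if \<phi> = \<psi> \<and> a = e \<and> b = c then of_nat (card (carrier G)) / of_nat (d \<psi>) else 0)"
    if "\<phi> \<in> \<Psi>" "\<psi> \<in> \<Psi>" "a < d \<phi>" "b < d \<phi>" "c < d \<psi>" "e < d \<psi>" for \<phi> \<psi> a b c e
  proof (cases "\<phi> = \<psi>")
    case True
    then show ?thesis
      using schur_orthogonality_same[OF irr] that by simp
  next
    case False
    have "\<exists>g\<in>carrier G. \<phi> g \<noteq> \<psi> g"
    proof (rule ccontr)
      assume "\<not> (\<exists>g\<in>carrier G. \<phi> g \<noteq> \<psi> g)"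
      then have "\<phi> g = \<psi> g" for g
        using dD(2)[OF that(1)] dD(2)[OF that(2)] by (metis restrict_apply)
      then show False
        using False by blast
    qed
    then obtain g where g: "g \<in> carrier G" "\<phi> g \<noteq> \<psi> g"
      by blast
    then have "mat_trace (D \<psi> g) \<noteq> mat_trace (D \<phi> g)"
      using tr[OF that(1)] tr[OF that(2)] by metis
    then show ?thesis
      using schur_orthogonality_distinct[OF irr[OF that(2)] irr[OF that(1)] g(1)] that False by simp
  qed
  let ?n = "of_nat (card (carrier G)) :: complex"
  have n: "?n \<noteq> 0"
    using G one_closed by (auto simp: card_eq_0_iff)
  define X where "X = (SIGMA \<psi>:\<Psi>. {..<d \<psi>})"
  \<comment> \<open>The standard operator projecting onto the \<open>a\<close>-th basis line of the
    constituent with character \<psi>.\<close>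
  define Q where "Q = (\<lambda>(\<psi>, a) i j. of_nat (d \<psi>) / ?n *
    (\<Sum>g\<in>carrier G. D \<psi> (inv g) $$ (a, a) * R g i j))"
  have X: "finite X"
    using fin\<Psi> by (simp add: X_def)
  have "of_nat (card I) = \<chi> \<one>"
    by (simp add: \<chi> trace_fun_def R_one)
  also have "\<dots> = (\<Sum>\<psi>\<in>\<Psi>. of_nat (d \<psi>))"
    using representation_ofD(3)[OF rep] by (simp add: \<chi>_sum_sum)
  also have "\<dots> = of_nat (card X)"
    using fin\<Psi> by (simp add: X_def)
  finally have "of_nat (card I) = (of_nat (card X) :: complex)" .
  then have cardX: "card X = card I"
    by (metis of_nat_eq_iff)
  have commQ: "mult_fun I S (Q x) i j = mult_fun I (Q x) S i j"
    if S: "\<And>g i j. g \<in> carrier G \<Longrightarrow> i \<in> I \<Longrightarrow> j \<in> I \<Longrightarrow> mult_fun I S (R g) i j = mult_fun I (R g) S i j"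
      and ij: "i \<in> I" "j \<in> I" for S x i j
  proof -
    obtain \<psi> a where x: "x = (\<psi>, a)"
      by fastforce
    have "mult_fun I S (Q x) i j = of_nat (d \<psi>) / ?n *
        (\<Sum>g\<in>carrier G. D \<psi> (inv g) $$ (a, a) * mult_fun I S (R g) i j)"
      by (simp add: mult_fun_def Q_def x sum_distrib_left sum.swap[of _ "carrier G" I] algebra_simps)
    also have "\<dots> = of_nat (d \<psi>) / ?n *
        (\<Sum>g\<in>carrier G. D \<psi> (inv g) $$ (a, a) * mult_fun I (R g) S i j)"
      using S ij by simp
    also have "\<dots> = mult_fun I (Q x) S i j"
      by (simp add: mult_fun_def Q_def x sum_distrib_left sum_distrib_right
          sum.swap[of _ "carrier G" I] algebra_simps)
    finally show ?thesis .
  qed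
  have trQ: "trace_fun I (Q x) = 1" if xX: "x \<in> X" for x
  proof -
    obtain \<psi> a where x: "x = (\<psi>, a)" "\<psi> \<in> \<Psi>" "a < d \<psi>"
      using xX by (auto simp: X_def)
    have "trace_fun I (Q x) = of_nat (d \<psi>) / ?n * (\<Sum>g\<in>carrier G. D \<psi> (inv g) $$ (a, a) * \<chi> g)"
      by (simp add: trace_fun_def Q_def x \<chi> sum_distrib_left sum.swap[of _ "carrier G" I])
    also have "(\<Sum>g\<in>carrier G. D \<psi> (inv g) $$ (a, a) * \<chi> g) =
        (\<Sum>g\<in>carrier G. \<Sum>\<phi>\<in>\<Psi>. \<Sum>b<d \<phi>. D \<phi> g $$ (b, b) * D \<psi> (inv g) $$ (a, a))"
      by (intro sum.cong refl) (simp add: \<chi>_sum_sum sum_distrib_left mult.commute)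
    also have "\<dots> = (\<Sum>\<phi>\<in>\<Psi>. \<Sum>b<d \<phi>. \<Sum>g\<in>carrier G. D \<phi> g $$ (b, b) * D \<psi> (inv g) $$ (a, a))"
      by (subst sum.swap) (intro sum.cong refl, subst sum.swap, rule refl)
    \<comment> \<open>By orthogonality only the term with \<open>\<phi> = \<psi>\<close> and
      \<open>b = a\<close> survives; that \<psi> is counted once in \<Psi> makes the trace
      one.\<close>
    also have "\<dots> = (\<Sum>\<phi>\<in>\<Psi>. \<Sum>b<d \<phi>. if \<phi> = \<psi> \<and> b = a then ?n / of_nat (d \<psi>) else 0)"
      using x by (intro sum.cong refl) (simp add: orth)
    also have "\<dots> = (\<Sum>\<phi>\<in>\<Psi>. if \<phi> = \<psi> then ?n / of_nat (d \<psi>) else 0)"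
      using x by (intro sum.cong refl) auto
    also have "\<dots> = ?n / of_nat (d \<psi>)"
      using x fin\<Psi> by simp
    finally show ?thesis
      using n d_pos[OF x(2)] by simp
  qed
  have QQ: "mult_fun I (Q x) (Q y) i j = (if x = y then Q x i j else 0)"
    if xyX: "x \<in> X" "y \<in> X" and ij: "i \<in> I" "j \<in> I" for x y i j
  proof -
    obtain \<psi> a \<phi> b where x: "x = (\<psi>, a)" "\<psi> \<in> \<Psi>" "a < d \<psi>" and y: "y = (\<phi>, b)" "\<phi> \<in> \<Psi>" "b < d \<phi>"
      using xyX by (auto simp: X_def)
    \<comment> \<open>Substituting \<open>k = g h\<close> splits \<open>D \<phi> (inv h)\<close>
      into \<open>D \<phi> (inv k) * D \<phi> g\<close>. The dependence on \<open>g\<close> is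
      thereby separated, and orthogonality applies to the sum over \<open>g\<close>.\<close>
    have inner: "(\<Sum>h\<in>carrier G. D \<phi> (inv h) $$ (b, b) * mult_fun I (R g) (R h) i j) =
        (\<Sum>k\<in>carrier G. \<Sum>c<d \<phi>. D \<phi> (inv k) $$ (b, c) * D \<phi> g $$ (c, b) * R k i j)"
      if g: "g \<in> carrier G" for g
    proof (rule sum.reindex_bij_witness[of _ "\<lambda>k. inv g \<otimes> k" "\<lambda>h. g \<otimes> h"])
      fix h assume h: "h \<in> carrier G"
      show "inv g \<otimes> (g \<otimes> h) = h" "g \<otimes> (inv g \<otimes> h) = h"
        using g h by (simp_all add: m_assoc[symmetric])
      show "g \<otimes> h \<in> carrier G" "inv g \<otimes> h \<in> carrier G"
        using g h by simp_all
      have "D \<phi> (inv h) = D \<phi> (inv (g \<otimes> h) \<otimes> g)"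
        using g h by (simp add: inv_mult_group m_assoc)
      also have "\<dots> = D \<phi> (inv (g \<otimes> h)) * D \<phi> g"
        using g h by (intro representation_ofD(2)[OF rep[OF y(2)]]) auto
      finally have "D \<phi> (inv h) $$ (b, b) = (\<Sum>c<d \<phi>. D \<phi> (inv (g \<otimes> h)) $$ (b, c) * D \<phi> g $$ (c, b))"
        using g h y by (simp only:) (rule mult_mat_entry[OF D[OF y(2)] D[OF y(2)]], auto)
      then show "(\<Sum>c<d \<phi>. D \<phi> (inv (g \<otimes> h)) $$ (b, c) * D \<phi> g $$ (c, b) * R (g \<otimes> h) i j)
          = D \<phi> (inv h) $$ (b, b) * mult_fun I (R g) (R h) i j"
        using g h ij by (simp add: R_mult sum_distrib_right)
    qed
    have "mult_fun I (Q x) (Q y) i j = of_nat (d \<psi>) / ?n * (of_nat (d \<phi>) / ?n) *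
        (\<Sum>k\<in>I. (\<Sum>g\<in>carrier G. D \<psi> (inv g) $$ (a, a) * R g i k) *
          (\<Sum>h\<in>carrier G. D \<phi> (inv h) $$ (b, b) * R h k j))"
      by (simp add: mult_fun_def Q_def x y sum_distrib_left mult_ac)
    also have "(\<Sum>k\<in>I. (\<Sum>g\<in>carrier G. D \<psi> (inv g) $$ (a, a) * R g i k) *
          (\<Sum>h\<in>carrier G. D \<phi> (inv h) $$ (b, b) * R h k j)) =
        (\<Sum>k\<in>I. \<Sum>g\<in>carrier G. \<Sum>h\<in>carrier G.
          D \<psi> (inv g) $$ (a, a) * (D \<phi> (inv h) $$ (b, b) * (R g i k * R h k j)))"
      unfolding sum_product by (simp add: mult_ac)
    also have "\<dots> = (\<Sum>g\<in>carrier G. \<Sum>h\<in>carrier G. \<Sum>k\<in>I.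
          D \<psi> (inv g) $$ (a, a) * (D \<phi> (inv h) $$ (b, b) * (R g i k * R h k j)))"
      by (subst sum.swap) (intro sum.cong refl, subst sum.swap, rule refl)
    also have "\<dots> = (\<Sum>g\<in>carrier G. D \<psi> (inv g) $$ (a, a) *
        (\<Sum>h\<in>carrier G. D \<phi> (inv h) $$ (b, b) * mult_fun I (R g) (R h) i j))"
      by (simp add: mult_fun_def sum_distrib_left)
    also have "\<dots> = (\<Sum>g\<in>carrier G. D \<psi> (inv g) $$ (a, a) *
        (\<Sum>k\<in>carrier G. \<Sum>c<d \<phi>. D \<phi> (inv k) $$ (b, c) * D \<phi> g $$ (c, b) * R k i j))"
      by (simp add: inner)
    also have "\<dots> = (\<Sum>g\<in>carrier G. \<Sum>k\<in>carrier G. \<Sum>c<d \<phi>.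
        D \<phi> (inv k) $$ (b, c) * R k i j * (D \<phi> g $$ (c, b) * D \<psi> (inv g) $$ (a, a)))"
      by (simp add: sum_distrib_left mult_ac)
    also have "\<dots> = (\<Sum>k\<in>carrier G. \<Sum>c<d \<phi>. \<Sum>g\<in>carrier G.
        D \<phi> (inv k) $$ (b, c) * R k i j * (D \<phi> g $$ (c, b) * D \<psi> (inv g) $$ (a, a)))"
      by (subst sum.swap) (intro sum.cong refl, subst sum.swap, rule refl)
    also have "\<dots> = (\<Sum>k\<in>carrier G. \<Sum>c<d \<phi>. D \<phi> (inv k) $$ (b, c) * R k i j *
        (if \<phi> = \<psi> \<and> c = a \<and> b = a then ?n / of_nat (d \<psi>) else 0))"
      using x y by (intro sum.cong refl) (simp add: sum_distrib_left[symmetric] orth)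
    also have "\<dots> = (\<Sum>k\<in>carrier G. if x = y then D \<psi> (inv k) $$ (a, a) * R k i j * (?n / of_nat (d \<psi>)) else 0)"
    proof (intro sum.cong refl)
      fix k
      have "(\<Sum>c<d \<phi>. D \<phi> (inv k) $$ (b, c) * R k i j *
          (if \<phi> = \<psi> \<and> c = a \<and> b = a then ?n / of_nat (d \<psi>) else 0)) =
        (\<Sum>c<d \<phi>. if c = a then (if x = y then D \<psi> (inv k) $$ (a, a) * R k i j * (?n / of_nat (d \<psi>)) else 0) else 0)"
        using x y by (intro sum.cong refl) auto
      also have "\<dots> = (if x = y then D \<psi> (inv k) $$ (a, a) * R k i j * (?n / of_nat (d \<psi>)) else 0)"
        using x y by auto
      finally show "(\<Sum>c<d \<phi>. D \<phi> (inv k) $$ (b, c) * R k i j *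
          (if \<phi> = \<psi> \<and> c = a \<and> b = a then ?n / of_nat (d \<psi>) else 0)) =
        (if x = y then D \<psi> (inv k) $$ (a, a) * R k i j * (?n / of_nat (d \<psi>)) else 0)" .
    qed
    also have "of_nat (d \<psi>) / ?n * (of_nat (d \<phi>) / ?n) * \<dots> = (if x = y then Q x i j else 0)"
    proof (cases "x = y")
      case True
      then show ?thesis
        using x y n d_pos[OF x(2)] by (simp add: Q_def sum_distrib_left[symmetric] sum_distrib_right[symmetric] sum_divide_distrib[symmetric])
    qed simp
    finally show ?thesis .
  qed
  show ?thesis
    by (rule commute_of_trace_one_idempotents[OF I X cardX QQ trQ commQ[OF S] commQ[OF T] ij])
qed

section \<open>Specht modules as matrix representations\<close>

lemma tabloid_action_add: "tabloid_action g (v + w) = tabloid_action g v + tabloid_action g w"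
  by (simp add: tabloid_action_def fun_eq_iff)

lemma tabloid_action_scale: "tabloid_action g (cfun_scale a v) = cfun_scale a (tabloid_action g v)"
  by (simp add: tabloid_action_def cfun_scale_def fun_eq_iff)

lemma tabloid_action_sum: "tabloid_action g (\<Sum>x\<in>X. f x) = (\<Sum>x\<in>X. tabloid_action g (f x))"
  by (induction X rule: infinite_finite_induct)
    (simp_all add: tabloid_action_add, simp_all add: tabloid_action_def fun_eq_iff)

lemma tabloid_action_id: "tabloid_action id v = v"
  by (simp add: tabloid_action_def)

lemma tabloid_action_comp:
  assumes "bij g" "bij h"
  shows "tabloid_action (g \<circ> h) v = tabloid_action g (tabloid_action h v)"
  using assms by (simp add: tabloid_action_def o_inv_distrib image_comp)

lemma row_entries_comp: "row_entries \<alpha> (g \<circ> t) i = g ` row_entries \<alpha> t i"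
  by (simp add: row_entries_def image_comp)

lemma column_entries_comp: "column_entries \<alpha> (g \<circ> t) j = g ` column_entries \<alpha> t j"
  by (simp add: column_entries_def image_comp)

lemma comp_tableaux:
  assumes "t \<in> tableaux \<alpha>" "g permutes {1..sum_list \<alpha>}"
  shows "g \<circ> t \<in> tableaux \<alpha>"
  using assms permutes_imp_bij bij_betw_trans unfolding tableaux_def by blast

lemma polytabloid_apply:
  "polytabloid \<alpha> t T =
    (\<Sum>\<pi>\<in>column_stabilizer \<alpha> t. of_int (sign \<pi>) * (if T = (\<lambda>i. \<pi> ` row_entries \<alpha> t i) then 1 else 0))"
  unfolding polytabloid_def by (simp add: row_entries_comp fun_eq_iff)

lemma tabloid_action_polytabloid_apply:
  assumes "g permutes {1..sum_list \<alpha>}"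
  shows "tabloid_action g (polytabloid \<alpha> t) T =
    (\<Sum>\<pi>\<in>column_stabilizer \<alpha> t. of_int (sign \<pi>) * (if T = (\<lambda>i. (g \<circ> \<pi>) ` row_entries \<alpha> t i) then 1 else 0))"
proof -
  have "(\<lambda>i. inv' g ` T i) = (\<lambda>i. \<pi> ` row_entries \<alpha> t i) \<longleftrightarrow> T = (\<lambda>i. (g \<circ> \<pi>) ` row_entries \<alpha> t i)" for \<pi>
  proof -
    have "inv' g ` A = \<pi> ` B \<longleftrightarrow> A = (g \<circ> \<pi>) ` B" for A B
      using permutes_bij[OF assms] by (metis bij_is_inj bij_is_surj image_comp image_f_inv_f image_inv_f_f)
    then show ?thesis
      by (simp add: fun_eq_iff)
  qed
  then show ?thesis
    by (simp add: tabloid_action_def polytabloid_apply)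
qed

lemma bij_betw_conj_column_stabilizer:
  assumes g: "g permutes {1..sum_list \<alpha>}"
  shows "bij_betw (\<lambda>\<pi>. g \<circ> \<pi> \<circ> inv' g) (column_stabilizer \<alpha> t) (column_stabilizer \<alpha> (g \<circ> t))"
proof (rule bij_betw_byWitness[where f'="\<lambda>\<pi>. inv' g \<circ> \<pi> \<circ> g"])
  note gi = permutes_inv[OF g]
  show "\<forall>\<pi>\<in>column_stabilizer \<alpha> t. inv' g \<circ> (g \<circ> \<pi> \<circ> inv' g) \<circ> g = \<pi>"
    "\<forall>\<pi>\<in>column_stabilizer \<alpha> (g \<circ> t). g \<circ> (inv' g \<circ> \<pi> \<circ> g) \<circ> inv' g = \<pi>"
    using g by (auto simp: fun_eq_iff permutes_inverses)
  show "(\<lambda>\<pi>. g \<circ> \<pi> \<circ> inv' g) ` column_stabilizer \<alpha> t \<subseteq> column_stabilizer \<alpha> (g \<circ> t)"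
  proof (rule image_subsetI)
    fix \<pi> assume "\<pi> \<in> column_stabilizer \<alpha> t"
    then have \<pi>: "\<pi> permutes {1..sum_list \<alpha>}" "\<And>j. \<pi> ` column_entries \<alpha> t j = column_entries \<alpha> t j"
      by (simp_all add: column_stabilizer_def)
    have "(g \<circ> \<pi> \<circ> inv' g) ` g ` column_entries \<alpha> t j = g ` column_entries \<alpha> t j" for j
      by (simp only: image_comp[symmetric] image_inv_f_f[OF permutes_inj[OF g]] \<pi>(2))
    moreover have "g \<circ> \<pi> \<circ> inv' g permutes {1..sum_list \<alpha>}"
      by (intro permutes_compose g gi \<pi>(1))
    ultimately show "g \<circ> \<pi> \<circ> inv' g \<in> column_stabilizer \<alpha> (g \<circ> t)"
      unfolding column_stabilizer_def column_entries_comp by blast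
  qed
  show "(\<lambda>\<pi>. inv' g \<circ> \<pi> \<circ> g) ` column_stabilizer \<alpha> (g \<circ> t) \<subseteq> column_stabilizer \<alpha> t"
  proof (rule image_subsetI)
    fix \<pi> assume "\<pi> \<in> column_stabilizer \<alpha> (g \<circ> t)"
    then have \<pi>: "\<pi> permutes {1..sum_list \<alpha>}" "\<And>j. \<pi> ` g ` column_entries \<alpha> t j = g ` column_entries \<alpha> t j"
      unfolding column_stabilizer_def column_entries_comp by blast+
    have "(inv' g \<circ> \<pi> \<circ> g) ` column_entries \<alpha> t j = column_entries \<alpha> t j" for j
      by (simp only: image_comp[symmetric] image_inv_f_f[OF permutes_inj[OF g]] \<pi>(2))
    moreover have "inv' g \<circ> \<pi> \<circ> g permutes {1..sum_list \<alpha>}"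
      by (intro permutes_compose g gi \<pi>(1))
    ultimately show "inv' g \<circ> \<pi> \<circ> g \<in> column_stabilizer \<alpha> t"
      unfolding column_stabilizer_def by blast
  qed
qed

text \<open>Conjugation by \<open>g\<close> carries the column stabilizer of \<open>t\<close> to
  that of \<open>g \<circ> t\<close> and preserves signs, so the two sums agree term by
  term.\<close>

lemma tabloid_action_polytabloid:
  assumes g: "g permutes {1..sum_list \<alpha>}"
  shows "tabloid_action g (polytabloid \<alpha> t) = polytabloid \<alpha> (g \<circ> t)"
proof
  fix T
  have "polytabloid \<alpha> (g \<circ> t) T = (\<Sum>\<pi>\<in>column_stabilizer \<alpha> t. of_int (sign (g \<circ> \<pi> \<circ> inv' g)) *
      (if T = (\<lambda>i. (g \<circ> \<pi> \<circ> inv' g) ` row_entries \<alpha> (g \<circ> t) i) then 1 else 0))"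
    unfolding polytabloid_apply
    by (rule sum.reindex_bij_betw[OF bij_betw_conj_column_stabilizer[OF g], symmetric])
  also have "\<dots> = (\<Sum>\<pi>\<in>column_stabilizer \<alpha> t. of_int (sign \<pi>) *
      (if T = (\<lambda>i. (g \<circ> \<pi>) ` row_entries \<alpha> t i) then 1 else 0))"
  proof (rule sum.cong[OF refl])
    fix \<pi> assume "\<pi> \<in> column_stabilizer \<alpha> t"
    then have "permutation \<pi>" "permutation g" "permutation (inv' g)"
      using g permutes_inv[OF g] by (auto simp: column_stabilizer_def permutation_permutes)
    then have "sign (g \<circ> \<pi> \<circ> inv' g) = sign \<pi>"
      by (simp add: sign_compose permutation_compose sign_inverse)
    moreover have "(g \<circ> \<pi> \<circ> inv' g) ` row_entries \<alpha> (g \<circ> t) i = (g \<circ> \<pi>) ` row_entries \<alpha> t i" for i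
      unfolding row_entries_comp image_comp comp_assoc permutes_inv_o[OF g] by simp
    ultimately show "of_int (sign (g \<circ> \<pi> \<circ> inv' g)) *
        (if T = (\<lambda>i. (g \<circ> \<pi> \<circ> inv' g) ` row_entries \<alpha> (g \<circ> t) i) then 1 else 0) =
      (of_int (sign \<pi>) * (if T = (\<lambda>i. (g \<circ> \<pi>) ` row_entries \<alpha> t i) then 1 else 0) :: complex)"
      by simp
  qed
  finally show "tabloid_action g (polytabloid \<alpha> t) T = polytabloid \<alpha> (g \<circ> t) T"
    by (simp only: tabloid_action_polytabloid_apply[OF g])
qed

lemma tabloid_action_specht_module:
  assumes g: "g permutes {1..sum_list \<alpha>}" and "v \<in> specht_module \<alpha>"
  shows "tabloid_action g v \<in> specht_module \<alpha>"
  using assms(2) unfolding specht_module_def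
proof (induction rule: cfun.span_induct_alt)
  case base
  have "tabloid_action g 0 = 0"
    by (simp add: tabloid_action_def fun_eq_iff)
  then have "tabloid_action g 0 \<in> cfun.span (polytabloid \<alpha> ` tableaux \<alpha>)"
    using cfun.span_zero by metis
  then show ?case
    by (simp only:)
next
  case (step c x y)
  then obtain t where "t \<in> tableaux \<alpha>" "x = polytabloid \<alpha> t"
    by blast
  then have "tabloid_action g x \<in> polytabloid \<alpha> ` tableaux \<alpha>"
    using comp_tableaux[OF _ g] tabloid_action_polytabloid[OF g] by auto
  then show ?case
    using step(2) unfolding tabloid_action_add tabloid_action_scale
    by (intro cfun.span_add cfun.span_scale) (auto intro: cfun.span_base)
qed

lemma finite_young_diagram: "finite (young_diagram \<alpha>)"
proof (rule finite_subset)
  show "young_diagram \<alpha> \<subseteq> (SIGMA i:{..<length \<alpha>}. {..<\<alpha> ! i})"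
    by (auto simp: young_diagram_def)
qed simp

text \<open>The set \<open>tableaux \<alpha>\<close> is infinite, since values outside the diagram
  are unconstrained, but a polytabloid depends only on the restriction of \<open>t\<close> to the
  diagram.\<close>

lemma finite_polytabloids: "finite (polytabloid \<alpha> ` tableaux \<alpha>)"
proof -
  have "polytabloid \<alpha> t = polytabloid \<alpha> (restrict t (young_diagram \<alpha>))" for t
  proof -
    have "row_entries \<alpha> t = row_entries \<alpha> (restrict t (young_diagram \<alpha>))"
      "column_entries \<alpha> t = column_entries \<alpha> (restrict t (young_diagram \<alpha>))"
      unfolding row_entries_def column_entries_def by (intro ext image_cong; simp)+
    then show ?thesis
      unfolding polytabloid_def column_stabilizer_def row_entries_comp[abs_def] by simp
  qed
  then have "polytabloid \<alpha> ` tableaux \<alpha> \<subseteq> polytabloid \<alpha> ` (young_diagram \<alpha> \<rightarrow>\<^sub>E {1..sum_list \<alpha>})"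
    by (auto simp: tableaux_def bij_betw_def intro!: image_eqI[of _ _ "restrict _ (young_diagram \<alpha>)"])
  moreover have "finite (young_diagram \<alpha> \<rightarrow>\<^sub>E {1..sum_list \<alpha>})"
    by (intro finite_PiE finite_young_diagram) simp
  ultimately show ?thesis
    using finite_subset by blast
qed

text \<open>The choice term is the one inside \<open>trace_on\<close>, so that the character is
  literally the trace of the matrices formed in this basis.\<close>

definition specht_basis :: "nat list \<Rightarrow> ((nat \<Rightarrow> nat set) \<Rightarrow> complex) set"
  where "specht_basis \<alpha> = (SOME B. \<not> cfun.dependent B \<and> cfun.span B = specht_module \<alpha>)"

lemma specht_basis:
  shows independent_specht_basis: "\<not> cfun.dependent (specht_basis \<alpha>)"
    and span_specht_basis: "cfun.span (specht_basis \<alpha>) = specht_module \<alpha>"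
    and finite_specht_basis: "finite (specht_basis \<alpha>)"
proof -
  have "\<exists>B. \<not> cfun.dependent B \<and> cfun.span B = specht_module \<alpha>"
    using cfun.basis_exists[of "specht_module \<alpha>"]
    by (metis cfun.span_mono cfun.span_span specht_module_def subset_antisym)
  from someI_ex[OF this]
  show B: "\<not> cfun.dependent (specht_basis \<alpha>)" "cfun.span (specht_basis \<alpha>) = specht_module \<alpha>"
    unfolding specht_basis_def by blast+
  show "finite (specht_basis \<alpha>)"
    using cfun.independent_span_bound[OF finite_polytabloids B(1)] B(2) cfun.span_superset
    unfolding specht_module_def by blast
qed

definition specht_matrix ::
    "nat list \<Rightarrow> (nat \<Rightarrow> nat) \<Rightarrow> ((nat \<Rightarrow> nat set) \<Rightarrow> complex) \<Rightarrow> ((nat \<Rightarrow> nat set) \<Rightarrow> complex) \<Rightarrow> complex"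
  where "specht_matrix \<alpha> g b c = cfun.representation (specht_basis \<alpha>) (tabloid_action g c) b"

lemma sym_character_eq_trace_specht_matrix:
  "sym_character \<alpha> g = trace_fun (specht_basis \<alpha>) (specht_matrix \<alpha> g)"
  by (simp add: sym_character_def trace_on_def trace_fun_def specht_matrix_def specht_basis_def Let_def)

lemma specht_basis_subset: "b \<in> specht_basis \<alpha> \<Longrightarrow> b \<in> specht_module \<alpha>"
  using cfun.span_base[of b "specht_basis \<alpha>"] by (simp add: span_specht_basis)

lemma specht_representation_sum:
  assumes "v \<in> specht_module \<alpha>"
  shows "(\<Sum>b\<in>specht_basis \<alpha>. cfun_scale (cfun.representation (specht_basis \<alpha>) v b) b) = v"
  using assms
  by (intro cfun.sum_representation_eq independent_specht_basis finite_specht_basis)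
    (simp_all add: span_specht_basis)

lemma specht_matrix_id:
  assumes "b \<in> specht_basis \<alpha>" "c \<in> specht_basis \<alpha>"
  shows "specht_matrix \<alpha> id b c = (if b = c then 1 else 0)"
  using assms by (simp add: specht_matrix_def tabloid_action_id cfun.representation_basis[OF independent_specht_basis])

lemma tabloid_action_specht_basis:
  assumes g: "g permutes {1..sum_list \<alpha>}" and v: "v \<in> specht_module \<alpha>"
  shows "tabloid_action g v = (\<Sum>b\<in>specht_basis \<alpha>. cfun_scale
    (\<Sum>c\<in>specht_basis \<alpha>. specht_matrix \<alpha> g b c * cfun.representation (specht_basis \<alpha>) v c) b)"
proof -
  let ?B = "specht_basis \<alpha>"
  have "tabloid_action g v = (\<Sum>c\<in>?B. cfun_scale (cfun.representation ?B v c) (tabloid_action g c))"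
    by (subst (1) specht_representation_sum[OF v, symmetric])
      (simp add: tabloid_action_sum tabloid_action_scale)
  also have "\<dots> = (\<Sum>c\<in>?B. cfun_scale (cfun.representation ?B v c)
      (\<Sum>b\<in>?B. cfun_scale (specht_matrix \<alpha> g b c) b))"
    unfolding specht_matrix_def
    by (intro sum.cong refl, subst specht_representation_sum)
      (auto intro: tabloid_action_specht_module[OF g] specht_basis_subset)
  also have "\<dots> = (\<Sum>c\<in>?B. \<Sum>b\<in>?B. cfun_scale (specht_matrix \<alpha> g b c * cfun.representation ?B v c) b)"
    by (simp add: cfun.scale_sum_right mult.commute)
  also have "\<dots> = (\<Sum>b\<in>?B. cfun_scale (\<Sum>c\<in>?B. specht_matrix \<alpha> g b c * cfun.representation ?B v c) b)"
    by (subst sum.swap) (simp add: cfun.scale_sum_left)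
  finally show ?thesis .
qed

lemma specht_matrix_mult:
  assumes g: "g permutes {1..sum_list \<alpha>}" and h: "h permutes {1..sum_list \<alpha>}"
    and bc: "b \<in> specht_basis \<alpha>" "c \<in> specht_basis \<alpha>"
  shows "mult_fun (specht_basis \<alpha>) (specht_matrix \<alpha> g) (specht_matrix \<alpha> h) b c = specht_matrix \<alpha> (g \<circ> h) b c"
proof -
  let ?B = "specht_basis \<alpha>"
  let ?r = "cfun.representation ?B"
  have "specht_matrix \<alpha> (g \<circ> h) b c = ?r (tabloid_action g (tabloid_action h c)) b"
    by (simp add: specht_matrix_def tabloid_action_comp permutes_bij[OF g] permutes_bij[OF h])
  also have "tabloid_action g (tabloid_action h c) =
      (\<Sum>b\<in>?B. cfun_scale (\<Sum>e\<in>?B. specht_matrix \<alpha> g b e * specht_matrix \<alpha> h e c) b)"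
    using bc by (subst tabloid_action_specht_basis[OF g])
      (simp_all add: tabloid_action_specht_module[OF h] specht_basis_subset specht_matrix_def)
  also have "?r \<dots> b = (\<Sum>d\<in>?B. (\<Sum>e\<in>?B. specht_matrix \<alpha> g d e * specht_matrix \<alpha> h e c) * ?r d b)"
    by (subst cfun.representation_sum[OF independent_specht_basis])
      (auto intro!: sum.cong intro: cfun.span_scale cfun.span_base
        simp: cfun.representation_scale[OF independent_specht_basis] cfun.span_base)
  also have "\<dots> = (\<Sum>d\<in>?B. if d = b then (\<Sum>e\<in>?B. specht_matrix \<alpha> g d e * specht_matrix \<alpha> h e c) else 0)"
    by (intro sum.cong refl) (simp add: cfun.representation_basis[OF independent_specht_basis])
  also have "\<dots> = mult_fun ?B (specht_matrix \<alpha> g) (specht_matrix \<alpha> h) b c"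
    using bc finite_specht_basis by (simp add: mult_fun_def)
  finally show ?thesis ..
qed

text \<open>A matrix coefficient of the Specht module: the vector is the polytabloid of
  \<open>t\<close>, and the functional reads off the coefficient of the tabloid of \<open>t\<close>
  itself.\<close>

definition tabloid_coeff :: "nat list \<Rightarrow> (nat \<times> nat \<Rightarrow> nat) \<Rightarrow> (nat \<Rightarrow> nat) \<Rightarrow> complex"
  where "tabloid_coeff \<alpha> t g = tabloid_action g (polytabloid \<alpha> t) (row_entries \<alpha> t)"

text \<open>The weights \<open>w\<close> do not depend on \<open>g\<close>, so linear identities
  between representing matrices pass to these coefficients. They are the values of the basis vectors
  at the tabloid times the coordinates of the polytabloid.\<close>

lemma tabloid_coeff_eq_matrix_coeff:
  assumes t: "t \<in> tableaux \<alpha>"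
  shows "\<exists>w. \<forall>g. g permutes {1..sum_list \<alpha>} \<longrightarrow>
    tabloid_coeff \<alpha> t g = (\<Sum>b\<in>specht_basis \<alpha>. \<Sum>c\<in>specht_basis \<alpha>. w b c * specht_matrix \<alpha> g b c)"
proof (intro exI allI impI)
  fix g assume g: "g permutes {1..sum_list \<alpha>}"
  have v: "polytabloid \<alpha> t \<in> specht_module \<alpha>"
    unfolding specht_module_def using t by (intro cfun.span_base) auto
  have sum_apply: "(\<Sum>b\<in>X. f b) T = (\<Sum>b\<in>X. f b T)" for X T and f :: "'x \<Rightarrow> 'y \<Rightarrow> complex"
    by (induction X rule: infinite_finite_induct) auto
  show "tabloid_coeff \<alpha> t g = (\<Sum>b\<in>specht_basis \<alpha>. \<Sum>c\<in>specht_basis \<alpha>.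
    (b (row_entries \<alpha> t) * cfun.representation (specht_basis \<alpha>) (polytabloid \<alpha> t) c) * specht_matrix \<alpha> g b c)"
    unfolding tabloid_coeff_def tabloid_action_specht_basis[OF g v]
    by (simp add: sum_apply cfun_scale_def sum_distrib_left sum_distrib_right mult_ac)
qed

section \<open>The commutator identity for transpositions\<close>

text \<open>The Kronecker product of three matrices, with triples as indices.\<close>

definition tensor_fun ::
    "('a \<Rightarrow> 'a \<Rightarrow> complex) \<Rightarrow> ('b \<Rightarrow> 'b \<Rightarrow> complex) \<Rightarrow> ('c \<Rightarrow> 'c \<Rightarrow> complex) \<Rightarrow>
      'a \<times> 'b \<times> 'c \<Rightarrow> 'a \<times> 'b \<times> 'c \<Rightarrow> complex"
  where "tensor_fun X Y Z = (\<lambda>(a, b, c) (a', b', c'). X a a' * Y b b' * Z c c')"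

lemma sum_Times_triple:
  fixes f g h :: "_ \<Rightarrow> complex"
  shows "(\<Sum>(a, b, c)\<in>A \<times> B \<times> C. f a * g b * h c) = sum f A * sum g B * sum h C"
  unfolding sum.cartesian_product[symmetric]
  by (simp add: sum_distrib_left[symmetric] sum_distrib_right[symmetric])

lemma mult_fun_tensor:
  "mult_fun (A \<times> B \<times> C) (tensor_fun X Y Z) (tensor_fun X' Y' Z') =
    tensor_fun (mult_fun A X X') (mult_fun B Y Y') (mult_fun C Z Z')"
proof (intro ext, clarify)
  fix a b c a' b' c'
  have "mult_fun (A \<times> B \<times> C) (tensor_fun X Y Z) (tensor_fun X' Y' Z') (a, b, c) (a', b', c') =
      (\<Sum>(k, l, m)\<in>A \<times> B \<times> C. (X a k * X' k a') * (Y b l * Y' l b') * (Z c m * Z' m c'))"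
    unfolding mult_fun_def tensor_fun_def by (intro sum.cong refl) (auto simp: mult_ac)
  then show "mult_fun (A \<times> B \<times> C) (tensor_fun X Y Z) (tensor_fun X' Y' Z') (a, b, c) (a', b', c') =
      tensor_fun (mult_fun A X X') (mult_fun B Y Y') (mult_fun C Z Z') (a, b, c) (a', b', c')"
    unfolding sum_Times_triple by (simp add: tensor_fun_def mult_fun_def)
qed

lemma trace_fun_tensor:
  "trace_fun (A \<times> B \<times> C) (tensor_fun X Y Z) = trace_fun A X * trace_fun B Y * trace_fun C Z"
  unfolding trace_fun_def sum_Times_triple[symmetric] tensor_fun_def by (intro sum.cong) auto

lemma comp_transpose_eq:
  assumes "inj g"
  shows "g \<circ> transpose a b = transpose (g a) (g b) \<circ> g"
  using assms by (auto simp: fun_eq_iff transpose_def inj_eq)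

text \<open>The identity compares matrix coefficients of the two products of the commuting operators \<open>S\<close> and
  \<open>T\<close>, the sums of all transpositions acting on the first two, resp. first and last, tensor factors.\<close>

lemma transposition_coeff_identity:
  fixes \<alpha> \<beta> \<gamma> :: "nat list" and n :: nat
  defines "P \<equiv> {1..n} \<times> {1..n}"
  assumes n: "sum_list \<alpha> = n" "sum_list \<beta> = n" "sum_list \<gamma> = n"
    and mf: "multiplicity_free (sym_group n) (\<lambda>g. sym_character \<alpha> g * sym_character \<beta> g * sym_character \<gamma> g)"
    and tab: "t \<in> tableaux \<alpha>" "s \<in> tableaux \<beta>" "r \<in> tableaux \<gamma>"
  shows "(\<Sum>(i, j)\<in>P. \<Sum>(k, l)\<in>P.
    tabloid_coeff \<beta> s (transpose i j) * tabloid_coeff \<gamma> r (transpose k l) *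
    (tabloid_coeff \<alpha> t (transpose i j \<circ> transpose k l) - tabloid_coeff \<alpha> t (transpose k l \<circ> transpose i j))) = 0"
proof -
  let ?A = "specht_basis \<alpha>" and ?B = "specht_basis \<beta>" and ?C = "specht_basis \<gamma>"
  define I where "I = ?A \<times> ?B \<times> ?C"
  define W where "W x y z = tensor_fun (specht_matrix \<alpha> x) (specht_matrix \<beta> y) (specht_matrix \<gamma> z)" for x y z
  define \<tau> where "\<tau> p = transpose (fst p) (snd p)" for p :: "nat \<times> nat"
  \<comment> \<open>Over ordered pairs every transposition occurs twice and the identity
    \<open>n\<close> times. Simultaneous conjugation permutes these pairs, so \<open>S\<close> and
    \<open>T\<close> commute with the diagonal action.\<close>
  define S where "S i j = (\<Sum>p\<in>P. W (\<tau> p) (\<tau> p) id i j)" for i j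
  define T where "T i j = (\<Sum>q\<in>P. W (\<tau> q) id (\<tau> q) i j)" for i j
  have finI: "finite I"
    by (simp add: I_def finite_specht_basis)
  have \<tau>: "\<tau> p permutes {1..n}" if "p \<in> P" for p
    using that by (auto simp: \<tau>_def P_def intro!: permutes_swap_id)
  have id: "id permutes {1..n}"
    by (rule permutes_id)
  have W_mult: "mult_fun I (W x y z) (W x' y' z') i j = W (x \<circ> x') (y \<circ> y') (z \<circ> z') i j"
    if "x permutes {1..n}" "y permutes {1..n}" "z permutes {1..n}"
      "x' permutes {1..n}" "y' permutes {1..n}" "z' permutes {1..n}" "i \<in> I" "j \<in> I"
    for x y z x' y' z' i j
    using that n unfolding I_def W_def mult_fun_tensor
    by (auto simp: tensor_fun_def specht_matrix_mult)
  have sum_mult: "mult_fun I (\<lambda>i j. \<Sum>p\<in>P. f p i j) g i j = (\<Sum>p\<in>P. mult_fun I (f p) g i j)"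
    "mult_fun I g (\<lambda>i j. \<Sum>p\<in>P. f p i j) i j = (\<Sum>p\<in>P. mult_fun I g (f p) i j)" for f g i j
    by (simp_all add: mult_fun_def sum_distrib_left sum_distrib_right sum.swap[of _ P I])
  have bij: "bij_betw (\<lambda>(i, j). (g i, g j)) P P" if g: "g permutes {1..n}" for g :: "nat \<Rightarrow> nat"
    unfolding P_def using permutes_imp_bij[OF g]
    by (intro bij_betw_byWitness[where f'="\<lambda>(i, j). (inv' g i, inv' g j)"])
      (use permutes_in_image[OF g] permutes_in_image[OF permutes_inv[OF g]] permutes_inverses[OF g] in auto)
  have conj: "\<tau> (g (fst p), g (snd p)) \<circ> g = g \<circ> \<tau> p" if g: "g permutes {1..n}" for g p
    by (simp add: \<tau>_def comp_transpose_eq permutes_inj[OF g])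
  have S: "mult_fun I S (W g g g) i j = mult_fun I (W g g g) S i j"
    and T: "mult_fun I T (W g g g) i j = mult_fun I (W g g g) T i j"
    if g: "g \<in> carrier (sym_group n)" and ij: "i \<in> I" "j \<in> I" for g i j
  proof -
    have g: "g permutes {1..n}"
      using that(1) by (simp add: sym_group_carrier)
    have "mult_fun I S (W g g g) i j = (\<Sum>p\<in>P. W (\<tau> p \<circ> g) (\<tau> p \<circ> g) g i j)"
      unfolding S_def[abs_def] sum_mult using W_mult \<tau> g id ij by (intro sum.cong) auto
    also have "\<dots> = (\<Sum>p\<in>P. W (g \<circ> \<tau> p) (g \<circ> \<tau> p) g i j)"
      by (subst sum.reindex_bij_betw[OF bij[OF g], symmetric]) (simp add: case_prod_unfold conj[OF g])
    also have "\<dots> = mult_fun I (W g g g) S i j"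
      unfolding S_def[abs_def] sum_mult using W_mult \<tau> g id ij by (intro sum.cong) auto
    finally show "mult_fun I S (W g g g) i j = mult_fun I (W g g g) S i j" .
    have "mult_fun I T (W g g g) i j = (\<Sum>p\<in>P. W (\<tau> p \<circ> g) g (\<tau> p \<circ> g) i j)"
      unfolding T_def[abs_def] sum_mult using W_mult \<tau> g id ij by (intro sum.cong) auto
    also have "\<dots> = (\<Sum>p\<in>P. W (g \<circ> \<tau> p) g (g \<circ> \<tau> p) i j)"
      by (subst sum.reindex_bij_betw[OF bij[OF g], symmetric]) (simp add: case_prod_unfold conj[OF g])
    also have "\<dots> = mult_fun I (W g g g) T i j"
      unfolding T_def[abs_def] sum_mult using W_mult \<tau> g id ij by (intro sum.cong) auto
    finally show "mult_fun I T (W g g g) i j = mult_fun I (W g g g) T i j" .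
  qed
  have comm: "mult_fun I S T i j = mult_fun I T S i j" if ij: "i \<in> I" "j \<in> I" for i j
  proof (rule group.commute_of_multiplicity_free[OF sym_group_is_group _ finI _ _ _ mf S T ij])
    show "finite (carrier (sym_group n))"
      by (simp add: sym_group_def finite_permutations)
    show "W \<one>\<^bsub>sym_group n\<^esub> \<one>\<^bsub>sym_group n\<^esub> \<one>\<^bsub>sym_group n\<^esub> i j = (if i = j then 1 else 0)"
      if "i \<in> I" "j \<in> I" for i j
      using that by (auto simp: I_def W_def tensor_fun_def sym_group_one specht_matrix_id split: if_splits)
    show "mult_fun I (W g g g) (W h h h) i j =
        W (g \<otimes>\<^bsub>sym_group n\<^esub> h) (g \<otimes>\<^bsub>sym_group n\<^esub> h) (g \<otimes>\<^bsub>sym_group n\<^esub> h) i j"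
      if "g \<in> carrier (sym_group n)" "h \<in> carrier (sym_group n)" "i \<in> I" "j \<in> I" for g h i j
      using that W_mult by (simp add: sym_group_carrier sym_group_mult)
    show "sym_character \<alpha> g * sym_character \<beta> g * sym_character \<gamma> g = trace_fun I (W g g g)" for g
      by (simp add: I_def W_def trace_fun_tensor sym_character_eq_trace_specht_matrix)
  qed
  \<comment> \<open>In both orders the second factor carries \<open>\<tau> p\<close> and the third
    \<open>\<tau> q\<close>. Only on the first factor do the two transpositions meet, so only there
    does the order matter.\<close>
  have ST: "mult_fun I S T i j = (\<Sum>p\<in>P. \<Sum>q\<in>P. W (\<tau> p \<circ> \<tau> q) (\<tau> p) (\<tau> q) i j)"
    and TS: "mult_fun I T S i j = (\<Sum>p\<in>P. \<Sum>q\<in>P. W (\<tau> q \<circ> \<tau> p) (\<tau> p) (\<tau> q) i j)"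
    if ij: "i \<in> I" "j \<in> I" for i j
  proof -
    show "mult_fun I S T i j = (\<Sum>p\<in>P. \<Sum>q\<in>P. W (\<tau> p \<circ> \<tau> q) (\<tau> p) (\<tau> q) i j)"
      unfolding S_def[abs_def] T_def[abs_def] sum_mult using W_mult \<tau> id ij by (intro sum.cong) auto
    have "mult_fun I T S i j = (\<Sum>q\<in>P. \<Sum>p\<in>P. W (\<tau> q \<circ> \<tau> p) (\<tau> p) (\<tau> q) i j)"
      unfolding S_def[abs_def] T_def[abs_def] sum_mult using W_mult \<tau> id ij
      by (intro sum.cong) auto
    then show "mult_fun I T S i j = (\<Sum>p\<in>P. \<Sum>q\<in>P. W (\<tau> q \<circ> \<tau> p) (\<tau> p) (\<tau> q) i j)"
      by (subst sum.swap)
  qed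
  obtain u where u: "\<And>g. g permutes {1..n} \<Longrightarrow> tabloid_coeff \<alpha> t g = (\<Sum>b\<in>?A. \<Sum>c\<in>?A. u b c * specht_matrix \<alpha> g b c)"
    using tabloid_coeff_eq_matrix_coeff[OF tab(1)] n by auto
  obtain v where v: "\<And>g. g permutes {1..n} \<Longrightarrow> tabloid_coeff \<beta> s g = (\<Sum>b\<in>?B. \<Sum>c\<in>?B. v b c * specht_matrix \<beta> g b c)"
    using tabloid_coeff_eq_matrix_coeff[OF tab(2)] n by auto
  obtain w where w: "\<And>g. g permutes {1..n} \<Longrightarrow> tabloid_coeff \<gamma> r g = (\<Sum>b\<in>?C. \<Sum>c\<in>?C. w b c * specht_matrix \<gamma> g b c)"
    using tabloid_coeff_eq_matrix_coeff[OF tab(3)] n by auto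
  \<comment> \<open>The three matrix coefficients combine into one linear functional, which sends
    \<open>W x y z\<close> to the product of the tabloid coefficients.\<close>
  define L where "L f = (\<Sum>i\<in>I. \<Sum>j\<in>I. tensor_fun u v w i j * f i j)" for f
  have L_W: "L (W x y z) = tabloid_coeff \<alpha> t x * tabloid_coeff \<beta> s y * tabloid_coeff \<gamma> r z"
    if "x permutes {1..n}" "y permutes {1..n}" "z permutes {1..n}" for x y z
  proof -
    have "(\<Sum>j\<in>I. tensor_fun u v w (a, b, c) j * W x y z (a, b, c) j) =
        (\<Sum>a'\<in>?A. u a a' * specht_matrix \<alpha> x a a') * (\<Sum>b'\<in>?B. v b b' * specht_matrix \<beta> y b b') *
        (\<Sum>c'\<in>?C. w c c' * specht_matrix \<gamma> z c c')" for a b c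
      unfolding sum_Times_triple[symmetric] I_def W_def tensor_fun_def by (intro sum.cong) auto
    then have "L (W x y z) = (\<Sum>(a, b, c)\<in>I. (\<Sum>a'\<in>?A. u a a' * specht_matrix \<alpha> x a a') *
        (\<Sum>b'\<in>?B. v b b' * specht_matrix \<beta> y b b') * (\<Sum>c'\<in>?C. w c c' * specht_matrix \<gamma> z c c'))"
      unfolding L_def by (intro sum.cong) auto
    then show ?thesis
      unfolding I_def sum_Times_triple using u v w that by simp
  qed
  have L_sum: "L (\<lambda>i j. \<Sum>p\<in>P. f p i j) = (\<Sum>p\<in>P. L (f p))" for f :: "nat \<times> nat \<Rightarrow> _"
  proof -
    have "L (\<lambda>i j. \<Sum>p\<in>P. f p i j) = (\<Sum>i\<in>I. \<Sum>j\<in>I. \<Sum>p\<in>P. tensor_fun u v w i j * f p i j)"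
      by (simp add: L_def sum_distrib_left)
    also have "\<dots> = (\<Sum>i\<in>I. \<Sum>p\<in>P. \<Sum>j\<in>I. tensor_fun u v w i j * f p i j)"
      by (intro sum.cong refl sum.swap)
    also have "\<dots> = (\<Sum>p\<in>P. L (f p))"
      unfolding L_def by (rule sum.swap)
    finally show ?thesis .
  qed
  have "L (mult_fun I S T) = L (mult_fun I T S)"
    unfolding L_def using comm by (intro sum.cong) auto
  moreover have "L (mult_fun I S T) = L (\<lambda>i j. \<Sum>p\<in>P. \<Sum>q\<in>P. W (\<tau> p \<circ> \<tau> q) (\<tau> p) (\<tau> q) i j)"
    unfolding L_def using ST by (intro sum.cong) auto
  moreover have "L (mult_fun I T S) = L (\<lambda>i j. \<Sum>p\<in>P. \<Sum>q\<in>P. W (\<tau> q \<circ> \<tau> p) (\<tau> p) (\<tau> q) i j)"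
    unfolding L_def using TS by (intro sum.cong) auto
  ultimately have "(\<Sum>p\<in>P. \<Sum>q\<in>P. L (W (\<tau> p \<circ> \<tau> q) (\<tau> p) (\<tau> q))) =
      (\<Sum>p\<in>P. \<Sum>q\<in>P. L (W (\<tau> q \<circ> \<tau> p) (\<tau> p) (\<tau> q)))"
    by (simp add: L_sum)
  then have "(\<Sum>p\<in>P. \<Sum>q\<in>P. L (W (\<tau> p \<circ> \<tau> q) (\<tau> p) (\<tau> q)) - L (W (\<tau> q \<circ> \<tau> p) (\<tau> p) (\<tau> q))) = 0"
    by (simp add: sum_subtractf)
  moreover have "(\<Sum>p\<in>P. \<Sum>q\<in>P. L (W (\<tau> p \<circ> \<tau> q) (\<tau> p) (\<tau> q)) - L (W (\<tau> q \<circ> \<tau> p) (\<tau> p) (\<tau> q))) =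
      (\<Sum>(i, j)\<in>P. \<Sum>(k, l)\<in>P.
        tabloid_coeff \<beta> s (transpose i j) * tabloid_coeff \<gamma> r (transpose k l) *
        (tabloid_coeff \<alpha> t (transpose i j \<circ> transpose k l) - tabloid_coeff \<alpha> t (transpose k l \<circ> transpose i j)))"
    unfolding case_prod_unfold \<tau>_def[symmetric]
    by (intro sum.cong refl) (simp only: L_W \<tau> permutes_compose, simp add: algebra_simps)
  ultimately show ?thesis
    by simp
qed

section \<open>Coefficients of tabloids in polytabloids\<close>

definition tab_row :: "nat list \<Rightarrow> (nat \<times> nat \<Rightarrow> nat) \<Rightarrow> nat \<Rightarrow> nat"
  where "tab_row \<alpha> t y = fst (inv_into (young_diagram \<alpha>) t y)"

definition tab_col :: "nat list \<Rightarrow> (nat \<times> nat \<Rightarrow> nat) \<Rightarrow> nat \<Rightarrow> nat"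
  where "tab_col \<alpha> t y = snd (inv_into (young_diagram \<alpha>) t y)"

lemma tab_row_col_eq:
  assumes "t \<in> tableaux \<alpha>" "z \<in> young_diagram \<alpha>"
  shows "tab_row \<alpha> t (t z) = fst z" "tab_col \<alpha> t (t z) = snd z"
  using assms by (simp_all add: tab_row_def tab_col_def tableaux_def bij_betw_def)

lemma tab_cell:
  assumes "t \<in> tableaux \<alpha>" "y \<in> {1..sum_list \<alpha>}"
  shows "(tab_row \<alpha> t y, tab_col \<alpha> t y) \<in> young_diagram \<alpha>" "t (tab_row \<alpha> t y, tab_col \<alpha> t y) = y"
proof -
  have "y \<in> t ` young_diagram \<alpha>"
    using assms by (simp add: tableaux_def bij_betw_def)
  then show "(tab_row \<alpha> t y, tab_col \<alpha> t y) \<in> young_diagram \<alpha>" "t (tab_row \<alpha> t y, tab_col \<alpha> t y) = y"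
    by (simp_all add: tab_row_def tab_col_def inv_into_into f_inv_into_f)
qed

lemma tab_row_col_inject:
  assumes "t \<in> tableaux \<alpha>" "y \<in> {1..sum_list \<alpha>}" "z \<in> {1..sum_list \<alpha>}"
    and "tab_row \<alpha> t y = tab_row \<alpha> t z" "tab_col \<alpha> t y = tab_col \<alpha> t z"
  shows "y = z"
  using assms tab_cell(2) by metis

lemma tableau_in_range:
  assumes "t \<in> tableaux \<alpha>" "z \<in> young_diagram \<alpha>"
  shows "t z \<in> {1..sum_list \<alpha>}"
  using assms by (auto simp: tableaux_def bij_betw_def)

lemma row_entries_eq:
  assumes "t \<in> tableaux \<alpha>"
  shows "row_entries \<alpha> t i = {y \<in> {1..sum_list \<alpha>}. tab_row \<alpha> t y = i}"
proof (intro subset_antisym subsetI)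
  fix y assume "y \<in> row_entries \<alpha> t i"
  then show "y \<in> {y \<in> {1..sum_list \<alpha>}. tab_row \<alpha> t y = i}"
    using tab_row_col_eq[OF assms] tableau_in_range[OF assms] by (auto simp: row_entries_def)
next
  fix y assume y: "y \<in> {y \<in> {1..sum_list \<alpha>}. tab_row \<alpha> t y = i}"
  then show "y \<in> row_entries \<alpha> t i"
    unfolding row_entries_def using tab_cell[OF assms, of y]
    by (intro image_eqI[of _ _ "(tab_row \<alpha> t y, tab_col \<alpha> t y)"]) auto
qed

lemma column_entries_eq:
  assumes "t \<in> tableaux \<alpha>"
  shows "column_entries \<alpha> t j = {y \<in> {1..sum_list \<alpha>}. tab_col \<alpha> t y = j}"
proof (intro subset_antisym subsetI)
  fix y assume "y \<in> column_entries \<alpha> t j"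
  then show "y \<in> {y \<in> {1..sum_list \<alpha>}. tab_col \<alpha> t y = j}"
    using tab_row_col_eq[OF assms] tableau_in_range[OF assms] by (auto simp: column_entries_def)
next
  fix y assume y: "y \<in> {y \<in> {1..sum_list \<alpha>}. tab_col \<alpha> t y = j}"
  then show "y \<in> column_entries \<alpha> t j"
    unfolding column_entries_def using tab_cell[OF assms, of y]
    by (intro image_eqI[of _ _ "(tab_row \<alpha> t y, tab_col \<alpha> t y)"]) auto
qed

text \<open>Turns setwise invariance of rows or columns into a pointwise condition on coordinates.
  For the converse, \<open>z\<close> is the image of \<open>inv' \<pi> z\<close>, which lies in the
  same fibre.\<close>

lemma permutes_preserves_fibres_iff:
  assumes \<pi>: "\<pi> permutes S"
  shows "(\<forall>j. \<pi> ` {y \<in> S. f y = j} = {y \<in> S. f y = j}) \<longleftrightarrow> (\<forall>y\<in>S. f (\<pi> y) = f y)"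
proof
  assume *: "\<forall>j. \<pi> ` {y \<in> S. f y = j} = {y \<in> S. f y = j}"
  show "\<forall>y\<in>S. f (\<pi> y) = f y"
  proof
    fix y assume "y \<in> S"
    then have "\<pi> y \<in> \<pi> ` {z \<in> S. f z = f y}"
      by auto
    then show "f (\<pi> y) = f y"
      using * by auto
  qed
next
  assume *: "\<forall>y\<in>S. f (\<pi> y) = f y"
  have "z \<in> \<pi> ` {y \<in> S. f y = f z}" if "z \<in> S" for z
  proof (rule image_eqI[of _ _ "inv' \<pi> z"])
    have "inv' \<pi> z \<in> S"
      using that by (simp only: permutes_in_image[OF permutes_inv[OF \<pi>]])
    moreover have "f (inv' \<pi> z) = f z"
      using bspec[OF * calculation] by (simp only: permutes_inverses(1)[OF \<pi>])
    ultimately show "inv' \<pi> z \<in> {y \<in> S. f y = f z}"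
      by simp
  qed (simp only: permutes_inverses(1)[OF \<pi>])
  then show "\<forall>j. \<pi> ` {y \<in> S. f y = j} = {y \<in> S. f y = j}"
    using * permutes_in_image[OF \<pi>] by auto
qed

text \<open>The summand of \<pi> yields the tabloid of \<open>t\<close> exactly if
  \<open>g \<circ> \<pi>\<close> maps every row of \<open>t\<close> to itself.\<close>

lemma tabloid_coeff_eq_sum:
  assumes t: "t \<in> tableaux \<alpha>" and g: "g permutes {1..sum_list \<alpha>}"
  shows "tabloid_coeff \<alpha> t g =
    (\<Sum>\<pi> | \<pi> permutes {1..sum_list \<alpha>} \<and> (\<forall>y\<in>{1..sum_list \<alpha>}. tab_col \<alpha> t (\<pi> y) = tab_col \<alpha> t y).
      of_int (sign \<pi>) * (if \<forall>y\<in>{1..sum_list \<alpha>}. tab_row \<alpha> t (g (\<pi> y)) = tab_row \<alpha> t y then 1 else 0))"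
proof -
  have "column_stabilizer \<alpha> t =
      {\<pi>. \<pi> permutes {1..sum_list \<alpha>} \<and> (\<forall>y\<in>{1..sum_list \<alpha>}. tab_col \<alpha> t (\<pi> y) = tab_col \<alpha> t y)}"
    unfolding column_stabilizer_def column_entries_eq[OF t]
    by (intro Collect_cong conj_cong refl permutes_preserves_fibres_iff)
  moreover have "row_entries \<alpha> t = (\<lambda>i. (g \<circ> \<pi>) ` row_entries \<alpha> t i) \<longleftrightarrow>
      (\<forall>y\<in>{1..sum_list \<alpha>}. tab_row \<alpha> t (g (\<pi> y)) = tab_row \<alpha> t y)"
    if "\<pi> permutes {1..sum_list \<alpha>}" for \<pi>
  proof -
    have "row_entries \<alpha> t = (\<lambda>i. (g \<circ> \<pi>) ` row_entries \<alpha> t i) \<longleftrightarrow>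
        (\<forall>i. (g \<circ> \<pi>) ` {y \<in> {1..sum_list \<alpha>}. tab_row \<alpha> t y = i} = {y \<in> {1..sum_list \<alpha>}. tab_row \<alpha> t y = i})"
      unfolding fun_eq_iff row_entries_eq[OF t] by (intro all_cong1 eq_commute)
    then show ?thesis
      unfolding permutes_preserves_fibres_iff[OF permutes_compose[OF that g]] by simp
  qed
  ultimately show ?thesis
    unfolding tabloid_coeff_def tabloid_action_polytabloid_apply[OF g]
    by (intro sum.cong) (simp_all del: comp_apply)
qed

text \<open>If \<pi> contributed, the preimages of \<open>y\<close> and \<open>z\<close> under \<pi>
  would share a column, because \<pi> preserves columns, and a row, because
  \<open>g \<circ> \<pi>\<close> preserves rows. They would then coincide.\<close>

lemma tabloid_coeff_eq_zero:
  assumes t: "t \<in> tableaux \<alpha>" and g: "g permutes {1..sum_list \<alpha>}"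
    and yz: "y \<in> {1..sum_list \<alpha>}" "z \<in> {1..sum_list \<alpha>}" "y \<noteq> z" "tab_col \<alpha> t y = tab_col \<alpha> t z"
      "tab_row \<alpha> t (g y) = tab_row \<alpha> t (g z)"
  shows "tabloid_coeff \<alpha> t g = 0"
  unfolding tabloid_coeff_eq_sum[OF t g]
proof (rule sum.neutral, rule ballI)
  let ?S = "{1..sum_list \<alpha>}"
  fix \<pi> assume "\<pi> \<in> {\<pi>. \<pi> permutes ?S \<and> (\<forall>y\<in>?S. tab_col \<alpha> t (\<pi> y) = tab_col \<alpha> t y)}"
  then have \<pi>: "\<pi> permutes ?S" and col: "\<And>y. y \<in> ?S \<Longrightarrow> tab_col \<alpha> t (\<pi> y) = tab_col \<alpha> t y"
    by auto
  have "\<not> (\<forall>y\<in>?S. tab_row \<alpha> t (g (\<pi> y)) = tab_row \<alpha> t y)"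
  proof
    assume row: "\<forall>y\<in>?S. tab_row \<alpha> t (g (\<pi> y)) = tab_row \<alpha> t y"
    have S: "inv' \<pi> y \<in> ?S" "inv' \<pi> z \<in> ?S"
      using yz(1,2) by (simp_all only: permutes_in_image[OF permutes_inv[OF \<pi>]])
    have "inv' \<pi> y = inv' \<pi> z"
      using tab_row_col_inject[OF t S] col[OF S(1)] col[OF S(2)] bspec[OF row S(1)] bspec[OF row S(2)] yz(4,5)
      by (simp add: permutes_inverses[OF \<pi>])
    then show False
      using yz(3) permutes_inverses(1)[OF \<pi>] by metis
  qed
  then show "of_int (sign \<pi>) * (if \<forall>y\<in>?S. tab_row \<alpha> t (g (\<pi> y)) = tab_row \<alpha> t y then 1 else 0) = (0::complex)"
    by simp
qed

text \<open>Row and column determine an entry, so \<sigma> is the only contributing element: for any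
  contributing \<pi>, the entry \<open>inv' \<sigma> (\<pi> z)\<close> has the row and the column of
  \<open>z\<close>.\<close>

lemma tabloid_coeff_eq_sign:
  assumes t: "t \<in> tableaux \<alpha>" and g: "g permutes {1..sum_list \<alpha>}" and \<sigma>: "\<sigma> permutes {1..sum_list \<alpha>}"
    and col: "\<And>y. y \<in> {1..sum_list \<alpha>} \<Longrightarrow> tab_col \<alpha> t (\<sigma> y) = tab_col \<alpha> t y"
    and row: "\<And>y. y \<in> {1..sum_list \<alpha>} \<Longrightarrow> tab_row \<alpha> t (g (\<sigma> y)) = tab_row \<alpha> t y"
  shows "tabloid_coeff \<alpha> t g = of_int (sign \<sigma>)"
proof -
  let ?S = "{1..sum_list \<alpha>}"
  let ?C = "{\<pi>. \<pi> permutes ?S \<and> (\<forall>y\<in>?S. tab_col \<alpha> t (\<pi> y) = tab_col \<alpha> t y)}"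
  have uniq: "\<pi> = \<sigma>" if "\<pi> \<in> ?C" and row': "\<forall>y\<in>?S. tab_row \<alpha> t (g (\<pi> y)) = tab_row \<alpha> t y" for \<pi>
  proof
    fix z
    have \<pi>: "\<pi> permutes ?S" and col': "\<And>y. y \<in> ?S \<Longrightarrow> tab_col \<alpha> t (\<pi> y) = tab_col \<alpha> t y"
      using that(1) by auto
    show "\<pi> z = \<sigma> z"
    proof (cases "z \<in> ?S")
      case True
      have w: "inv' \<sigma> (\<pi> z) \<in> ?S"
        using True by (simp only: permutes_in_image[OF permutes_inv[OF \<sigma>]] permutes_in_image[OF \<pi>])
      have "inv' \<sigma> (\<pi> z) = z"
        using tab_row_col_inject[OF t w True] col[OF w] row[OF w] col'[OF True] bspec[OF row' True]
        by (simp add: permutes_inverses[OF \<sigma>])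
      then show ?thesis
        using permutes_inverses(1)[OF \<sigma>] by metis
    next
      case False
      then show ?thesis
        using \<pi> \<sigma> by (simp add: permutes_not_in)
    qed
  qed
  have "finite ?C"
    using finite_permutations[of ?S] by (rule finite_subset[rotated]) auto
  moreover have "\<sigma> \<in> ?C"
    using \<sigma> col by simp
  ultimately have "tabloid_coeff \<alpha> t g =
      (\<Sum>\<pi>\<in>{\<sigma>}. of_int (sign \<pi>) * (if \<forall>y\<in>?S. tab_row \<alpha> t (g (\<pi> y)) = tab_row \<alpha> t y then 1 else 0))"
    unfolding tabloid_coeff_eq_sum[OF t g] using uniq by (intro sum.mono_neutral_right) auto
  then show ?thesis
    using row by simp
qed

lemma young_diagram_downward_closed:
  assumes "sorted_wrt (\<ge>) \<alpha>" "(i, j) \<in> young_diagram \<alpha>" "i' \<le> i" "j' \<le> j"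
  shows "(i', j') \<in> young_diagram \<alpha>"
proof -
  have "\<alpha> ! i \<le> \<alpha> ! i'"
    using assms sorted_wrt_nth_less[OF assms(1), of i' i] by (cases "i' = i") (auto simp: young_diagram_def)
  then show ?thesis
    using assms by (auto simp: young_diagram_def)
qed

text \<open>If \<open>i\<close> lies above \<open>j\<close> in a different column, then the cell in the row of \<open>i\<close> and the
  column of \<open>j\<close> exists, and after the transposition its entry shares a row with \<open>i\<close>.\<close>

lemma tabloid_coeff_transpose:
  assumes \<alpha>: "sorted_wrt (\<ge>) \<alpha>" and t: "t \<in> tableaux \<alpha>"
    and ij: "i \<in> {1..sum_list \<alpha>}" "j \<in> {1..sum_list \<alpha>}"
  shows "tabloid_coeff \<alpha> t (transpose i j) =
    (if tab_row \<alpha> t i = tab_row \<alpha> t j then 1 else if tab_col \<alpha> t i = tab_col \<alpha> t j then -1 else 0)"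
proof -
  let ?r = "tab_row \<alpha> t" and ?c = "tab_col \<alpha> t"
  have perm: "transpose i j permutes {1..sum_list \<alpha>}"
    using ij by (rule permutes_swap_id)
  have zero: "tabloid_coeff \<alpha> t (transpose i j) = 0"
    if ij: "i \<in> {1..sum_list \<alpha>}" "j \<in> {1..sum_list \<alpha>}" and "?r i < ?r j" "?c i \<noteq> ?c j" for i j
  proof -
    let ?w = "(?r i, ?c j)"
    have w: "?w \<in> young_diagram \<alpha>"
      using young_diagram_downward_closed[OF \<alpha> tab_cell(1)[OF t ij(2)]] that(3) by simp
    note rc = tab_row_col_eq[OF t w]
    have "t ?w \<noteq> i" "t ?w \<noteq> j"
      using rc that(3,4) by auto
    then show ?thesis
      using rc by (intro tabloid_coeff_eq_zero[OF t permutes_swap_id[OF ij] tableau_in_range[OF t w] ij(2)]) auto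
  qed
  show ?thesis
  proof (cases "?r i = ?r j")
    case True
    have "tabloid_coeff \<alpha> t (transpose i j) = of_int (sign (id :: nat \<Rightarrow> nat))"
      using True by (intro tabloid_coeff_eq_sign[OF t perm permutes_id]) (auto simp: transpose_def)
    then show ?thesis
      using True by simp
  next
    case False
    show ?thesis
    proof (cases "?c i = ?c j")
      case True
      have "tabloid_coeff \<alpha> t (transpose i j) = of_int (sign (transpose i j))"
        using True by (intro tabloid_coeff_eq_sign[OF t perm perm]) (auto simp: transpose_def)
      then show ?thesis
        using True False by (auto simp: sign_swap_id)
    next
      case c: False
      show ?thesis
        using zero[OF ij] zero[OF ij(2,1)] False c by (cases "?r i < ?r j") (auto simp: transpose_commute)
    qed
  qed
qed

section \<open>Transposition coefficients\<close>

lemma card_young_diagram: "card (young_diagram \<alpha>) = sum_list \<alpha>"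
proof -
  have "young_diagram \<alpha> = (SIGMA i:{..<length \<alpha>}. {..<\<alpha> ! i})"
    by (auto simp: young_diagram_def)
  then show ?thesis
    by (simp add: sum_list_sum_nth lessThan_atLeast0)
qed

text \<open>Once the tails are matched, composing with the transposition of \<open>\<pi> x\<close>
  and \<open>y\<close> corrects the head; it fixes \<open>ys\<close>, which contains neither of the
  two.\<close>

lemma permutes_extending_lists:
  assumes "length xs = length ys" "distinct xs" "distinct ys" "set xs \<subseteq> S" "set ys \<subseteq> S"
  shows "\<exists>\<pi>. \<pi> permutes S \<and> map \<pi> xs = ys"
  using assms
proof (induction xs ys rule: list_induct2)
  case Nil
  then show ?case
    by (auto intro!: exI[of _ id] permutes_id)
next
  case (Cons x xs y ys)
  then obtain \<pi> where \<pi>: "\<pi> permutes S" "map \<pi> xs = ys"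
    by auto
  have "\<pi> x \<notin> set ys"
    using \<pi> Cons.prems(1) permutes_inj[OF \<pi>(1)] by (auto simp: inj_eq)
  then have "map (transpose (\<pi> x) y) ys = ys"
    using Cons.prems(2) by (intro map_idI) (auto simp: transpose_def)
  then have "map (transpose (\<pi> x) y \<circ> \<pi>) (x # xs) = y # ys"
    unfolding map_map[symmetric] by (simp add: \<pi>(2))
  moreover have "\<pi> x \<in> S" "y \<in> S"
    using Cons.prems(3,4) permutes_in_image[OF \<pi>(1), of x] by simp_all
  then have "transpose (\<pi> x) y \<circ> \<pi> permutes S"
    by (intro permutes_compose[OF \<pi>(1)] permutes_swap_id)
  ultimately show ?case
    by (intro exI conjI)
qed

text \<open>An arbitrary filling is relabelled so that prescribed cells receive prescribed entries.
  Empty lists give the mere existence of a tableau.\<close>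

lemma tableau_with_entries:
  assumes "length zs = length ys" "distinct zs" "distinct ys"
    and "set zs \<subseteq> young_diagram \<alpha>" "set ys \<subseteq> {1..sum_list \<alpha>}"
  shows "\<exists>t\<in>tableaux \<alpha>. map t zs = ys"
proof -
  obtain t where t: "bij_betw t (young_diagram \<alpha>) {1..sum_list \<alpha>}"
    using finite_same_card_bij[OF finite_young_diagram[of \<alpha>], of "{1..sum_list \<alpha>}"] card_young_diagram by auto
  have "distinct (map t zs)"
    using assms(2,4) bij_betw_imp_inj_on[OF t] by (auto simp: distinct_map intro: inj_on_subset)
  moreover have "set (map t zs) \<subseteq> {1..sum_list \<alpha>}"
    using assms(4) t by (auto simp: bij_betw_def)
  ultimately have "\<exists>\<pi>. \<pi> permutes {1..sum_list \<alpha>} \<and> map \<pi> (map t zs) = ys"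
    using assms by (intro permutes_extending_lists) simp_all
  then obtain \<pi> where \<pi>: "\<pi> permutes {1..sum_list \<alpha>}" "map \<pi> (map t zs) = ys"
    by blast
  then show ?thesis
    using comp_tableaux[OF _ \<pi>(1), of t] t by (intro bexI[of _ "\<pi> \<circ> t"]) (auto simp: tableaux_def)
qed

lemma tab_row_col_transpose:
  assumes t: "t \<in> tableaux \<alpha>" and S: "a \<in> {1..sum_list \<alpha>}" "b \<in> {1..sum_list \<alpha>}" "y \<in> {1..sum_list \<alpha>}"
  shows "tab_row \<alpha> (transpose a b \<circ> t) y = tab_row \<alpha> t (transpose a b y)"
    and "tab_col \<alpha> (transpose a b \<circ> t) y = tab_col \<alpha> t (transpose a b y)"
proof -
  have y: "transpose a b y \<in> {1..sum_list \<alpha>}"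
    using S by (auto simp: transpose_def)
  let ?z = "(tab_row \<alpha> t (transpose a b y), tab_col \<alpha> t (transpose a b y))"
  have "(transpose a b \<circ> t) ?z = y"
    using tab_cell(2)[OF t y] by simp
  then show "tab_row \<alpha> (transpose a b \<circ> t) y = tab_row \<alpha> t (transpose a b y)"
    "tab_col \<alpha> (transpose a b \<circ> t) y = tab_col \<alpha> t (transpose a b y)"
    using tab_row_col_eq[OF comp_tableaux[OF t permutes_swap_id[OF S(1,2)]] tab_cell(1)[OF t y]] by simp_all
qed

text \<open>The value zero outside the range gives total functions on pairs, so that spans and
  equalities make sense in the ambient function space.\<close>

definition transposition_coeffs :: "nat list \<Rightarrow> (nat \<times> nat \<Rightarrow> nat) \<Rightarrow> nat \<times> nat \<Rightarrow> complex"
  where "transposition_coeffs \<alpha> t = (\<lambda>(i, j).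
    if i \<in> {1..sum_list \<alpha>} \<and> j \<in> {1..sum_list \<alpha>} then tabloid_coeff \<alpha> t (transpose i j) else 0)"

definition coeff_space :: "nat list \<Rightarrow> (nat \<times> nat \<Rightarrow> complex) set"
  where "coeff_space \<alpha> = cfun.span (transposition_coeffs \<alpha> ` tableaux \<alpha>)"

lemma transposition_coeffs_in_coeff_space:
  "t \<in> tableaux \<alpha> \<Longrightarrow> transposition_coeffs \<alpha> t \<in> coeff_space \<alpha>"
  unfolding coeff_space_def by (intro cfun.span_base) simp

text \<open>The coefficient at a transposition depends only on the rows and columns of its two
  entries, so relabelling the tableau amounts to relabelling the arguments.\<close>

lemma transposition_coeffs_transpose:
  assumes \<alpha>: "sorted_wrt (\<ge>) \<alpha>" and t: "t \<in> tableaux \<alpha>"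
    and S: "a \<in> {1..sum_list \<alpha>}" "b \<in> {1..sum_list \<alpha>}"
  shows "transposition_coeffs \<alpha> (transpose a b \<circ> t) (i, j) =
    transposition_coeffs \<alpha> t (transpose a b i, transpose a b j)"
proof -
  define S where "S = {1..sum_list \<alpha>}"
  have "transpose a b k \<in> S \<longleftrightarrow> k \<in> S" for k
    unfolding S_def by (rule permutes_in_image[OF permutes_swap_id[OF S]])
  note mem = this
  have coeffs: "transposition_coeffs \<alpha> s (i, j) =
      (if i \<in> S \<and> j \<in> S then tabloid_coeff \<alpha> s (transpose i j) else 0)" for s i j
    by (simp only: transposition_coeffs_def S_def prod.case)
  show ?thesis
  proof (cases "i \<in> S \<and> j \<in> S")
    case True
    then have ij: "i \<in> {1..sum_list \<alpha>}" "j \<in> {1..sum_list \<alpha>}"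
      "transpose a b i \<in> {1..sum_list \<alpha>}" "transpose a b j \<in> {1..sum_list \<alpha>}"
      unfolding S_def[symmetric] by (simp_all only: mem simp_thms)
    show ?thesis
      using True unfolding coeffs mem tabloid_coeff_transpose[OF \<alpha> t ij(3,4)]
        tabloid_coeff_transpose[OF \<alpha> comp_tableaux[OF t permutes_swap_id[OF S]] ij(1,2)]
        tab_row_col_transpose[OF t S ij(1)] tab_row_col_transpose[OF t S ij(2)] by simp
  next
    case False
    then show ?thesis
      by (simp only: coeffs mem if_False)
  qed
qed

section \<open>Edge functions and alternating cycles in the coefficient space\<close>

definition edge :: "nat \<Rightarrow> nat \<Rightarrow> nat \<times> nat \<Rightarrow> complex"
  where "edge a b = (\<lambda>p. if p = (a, b) \<or> p = (b, a) then 1 else 0)"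

lemma edge_commute: "edge a b = edge b a"
  by (auto simp: edge_def)

definition four_cycle :: "nat \<Rightarrow> nat \<Rightarrow> nat \<Rightarrow> nat \<Rightarrow> nat \<times> nat \<Rightarrow> complex"
  where "four_cycle a b c d = edge a b + edge c d - edge b c - edge d a"

text \<open>Applying \<open>(1 - (a c)) (1 - (b d))\<close> to a function on pairs projects it onto the alternating
  \<open>4\<close>-cycle.\<close>

lemma four_cycle_projection:
  fixes k :: "nat \<times> nat \<Rightarrow> complex"
  assumes "distinct [a, b, c, d]"
    and sym: "\<And>i j. k (i, j) = k (j, i)" and diag: "\<And>i. i \<in> {a, b, c, d} \<Longrightarrow> k (i, i) = m"
  shows "k (i, j) - k (transpose a c i, transpose a c j) - k (transpose b d i, transpose b d j)
      + k (transpose b d (transpose a c i), transpose b d (transpose a c j))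
    = (k (a, b) + k (c, d) - k (b, c) - k (d, a)) * four_cycle a b c d (i, j)"
proof -
  have ne: "a \<noteq> b" "a \<noteq> c" "a \<noteq> d" "b \<noteq> c" "b \<noteq> d" "c \<noteq> d"
    using assms(1) by auto
  have s: "k (b, a) = k (a, b)" "k (c, b) = k (b, c)" "k (d, c) = k (c, d)" "k (a, d) = k (d, a)"
    "k (c, a) = k (a, c)" "k (d, b) = k (b, d)"
    by (rule sym)+
  have m: "k (a, a) = m" "k (b, b) = m" "k (c, c) = m" "k (d, d) = m"
    by (rule diag; simp)+
  have i: "i = a \<or> i = b \<or> i = c \<or> i = d \<or> i \<notin> {a, b, c, d}"
    by blast
  have j: "j = a \<or> j = b \<or> j = c \<or> j = d \<or> j \<notin> {a, b, c, d}"
    by blast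
  show ?thesis
    using i j
    by (elim disjE; simp add: four_cycle_def edge_def transpose_def ne ne[symmetric] s m)
qed

lemma coeff_space_add: "f \<in> coeff_space \<alpha> \<Longrightarrow> g \<in> coeff_space \<alpha> \<Longrightarrow> f + g \<in> coeff_space \<alpha>"
  unfolding coeff_space_def by (rule cfun.span_add)

lemma coeff_space_diff: "f \<in> coeff_space \<alpha> \<Longrightarrow> g \<in> coeff_space \<alpha> \<Longrightarrow> f - g \<in> coeff_space \<alpha>"
  unfolding coeff_space_def by (rule cfun.span_diff)

lemma coeff_space_scale: "f \<in> coeff_space \<alpha> \<Longrightarrow> cfun_scale c f \<in> coeff_space \<alpha>"
  unfolding coeff_space_def by (rule cfun.span_scale)

lemma coeff_space_sum: "(\<And>x. x \<in> X \<Longrightarrow> f x \<in> coeff_space \<alpha>) \<Longrightarrow> sum f X \<in> coeff_space \<alpha>"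
  unfolding coeff_space_def by (rule cfun.span_sum)

lemma coeff_space_cancel_scale:
  assumes "cfun_scale c f \<in> coeff_space \<alpha>" "c \<noteq> 0"
  shows "f \<in> coeff_space \<alpha>"
proof -
  have "cfun_scale (inverse c) (cfun_scale c f) = f"
    using assms(2) by (simp add: cfun_scale_def fun_eq_iff mult.assoc[symmetric])
  then show ?thesis
    using coeff_space_scale[OF assms(1), of "inverse c"] by (simp only:)
qed

text \<open>In a tableau with \<open>a\<close> in the corner, \<open>b\<close> and \<open>d\<close>
  as its right and lower neighbours and \<open>c\<close> in the cell \<open>z\<close>, the
  projection to the cycle is a combination of relabelled coefficient functions, and its factor is
  nonzero.\<close>

lemma four_cycle_in_coeff_space:
  assumes \<alpha>: "sorted_wrt (\<ge>) \<alpha>" and abcd: "distinct [a, b, c, d]" "{a, b, c, d} \<subseteq> {1..sum_list \<alpha>}"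
    and diagram: "(0, 1) \<in> young_diagram \<alpha>" "(1, 0) \<in> young_diagram \<alpha>"
      "z \<in> young_diagram \<alpha>" "z \<in> {(1, 1), (0, 2), (2, 0)}"
  shows "four_cycle a b c d \<in> coeff_space \<alpha>"
proof -
  have origin: "(0, 0) \<in> young_diagram \<alpha>"
    by (rule young_diagram_downward_closed[OF \<alpha> diagram(1)]) auto
  have "\<exists>t\<in>tableaux \<alpha>. map t [(0, 0), (0, 1), z, (1, 0)] = [a, b, c, d]"
    using assms origin by (intro tableau_with_entries) auto
  then obtain t where t: "t \<in> tableaux \<alpha>" "t (0, 0) = a" "t (0, 1) = b" "t z = c" "t (1, 0) = d"
    by auto
  note rc = tab_row_col_eq[OF t(1)]
  have r: "tab_row \<alpha> t a = 0" "tab_col \<alpha> t a = 0" "tab_row \<alpha> t b = 0" "tab_col \<alpha> t b = 1"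
    "tab_row \<alpha> t c = fst z" "tab_col \<alpha> t c = snd z" "tab_row \<alpha> t d = 1" "tab_col \<alpha> t d = 0"
    using rc[OF origin] rc[OF diagram(1)] rc[OF diagram(2)] rc[OF diagram(3)] t by simp_all
  have S: "a \<in> {1..sum_list \<alpha>}" "b \<in> {1..sum_list \<alpha>}" "c \<in> {1..sum_list \<alpha>}" "d \<in> {1..sum_list \<alpha>}"
    using abcd(2) by blast+
  note tc = tabloid_coeff_transpose[OF \<alpha> t(1)]
  have tc_id: "tabloid_coeff \<alpha> t id = 1"
    using tc[OF S(1) S(1)] by simp
  let ?k = "transposition_coeffs \<alpha> t"
  let ?m = "?k (a, b) + ?k (c, d) - ?k (b, c) - ?k (d, a)"
  \<comment> \<open>The factor is 4 if \<open>z\<close> is the diagonal cell \<open>(1, 1)\<close>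
    and 1 in the other two cases.\<close>
  have m: "?m \<noteq> 0"
    using diagram(4) S unfolding transposition_coeffs_def by (auto simp: tc r)
  have t': "transpose a c \<circ> t \<in> tableaux \<alpha>" "transpose b d \<circ> t \<in> tableaux \<alpha>"
    "transpose a c \<circ> (transpose b d \<circ> t) \<in> tableaux \<alpha>"
    by (intro comp_tableaux permutes_swap_id t(1) S)+
  have "cfun_scale ?m (four_cycle a b c d) = ?k - transposition_coeffs \<alpha> (transpose a c \<circ> t)
      - transposition_coeffs \<alpha> (transpose b d \<circ> t)
      + transposition_coeffs \<alpha> (transpose a c \<circ> (transpose b d \<circ> t))"
  proof (rule ext, clarify)
    fix i j
    have "?k (i, j) = ?k (j, i)" for i j
      by (simp add: transposition_coeffs_def transpose_commute)
    moreover have "?k (i, i) = 1" if "i \<in> {a, b, c, d}" for i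
      using that S by (auto simp: transposition_coeffs_def tc_id)
    ultimately have "?m * four_cycle a b c d (i, j) = ?k (i, j) - ?k (transpose a c i, transpose a c j)
        - ?k (transpose b d i, transpose b d j)
        + ?k (transpose b d (transpose a c i), transpose b d (transpose a c j))"
      by (intro four_cycle_projection[OF abcd(1), symmetric])
    then show "cfun_scale ?m (four_cycle a b c d) (i, j) = (?k - transposition_coeffs \<alpha> (transpose a c \<circ> t)
        - transposition_coeffs \<alpha> (transpose b d \<circ> t)
        + transposition_coeffs \<alpha> (transpose a c \<circ> (transpose b d \<circ> t))) (i, j)"
      by (simp only: cfun_scale_def plus_fun_apply minus_apply
          transposition_coeffs_transpose[OF \<alpha> t(1) S(1,3)] transposition_coeffs_transpose[OF \<alpha> t(1) S(2,4)]
          transposition_coeffs_transpose[OF \<alpha> t'(2) S(1,3)])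
  qed
  also have "\<dots> \<in> coeff_space \<alpha>"
    by (intro coeff_space_add coeff_space_diff transposition_coeffs_in_coeff_space t t')
  finally show ?thesis
    using m by (rule coeff_space_cancel_scale)
qed

lemma sum_fun_apply: "(\<Sum>x\<in>X. f x) y = (\<Sum>x\<in>X. f x y)" for f :: "'x \<Rightarrow> 'y \<Rightarrow> complex"
  by (induction X rule: infinite_finite_induct) auto

lemma sum_edge:
  assumes "finite Z" "x \<notin> Z"
  shows "(\<Sum>z\<in>Z. edge z x (i, j)) = (if j = x \<and> i \<in> Z then 1 else 0) + (if i = x \<and> j \<in> Z then 1 else 0)"
proof -
  have "(\<Sum>z\<in>Z. edge z x (i, j)) =
      (\<Sum>z\<in>Z. (if z = i then if j = x then 1 else 0 else 0) + (if z = j then if i = x then 1 else 0 else 0))"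
    using assms(2) by (intro sum.cong) (auto simp: edge_def)
  then show ?thesis
    using assms(1) by (simp add: sum.distrib)
qed

text \<open>For the coefficient function \<open>k\<close> of a hook tableau with corner \<open>z\<close>, arm entry \<open>x\<close> and leg
  entry \<open>y\<close>, the difference \<open>(1 - (x y)) k\<close> is \<open>(z x) - (z y)\<close> plus a term \<open>e\<close> independent of \<open>z\<close>;
  summing over \<open>z\<close> gives a nonzero multiple of \<open>e\<close>.\<close>

lemma edge_diff_in_coeff_space_if_hook:
  assumes \<alpha>: "sorted_wrt (\<ge>) \<alpha>" and oxy: "distinct [u, x, y]" "{u, x, y} \<subseteq> {1..sum_list \<alpha>}"
    and diagram: "(0, 1) \<in> young_diagram \<alpha>" "(1, 0) \<in> young_diagram \<alpha>" "(1, 1) \<notin> young_diagram \<alpha>"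
  shows "edge u x - edge u y \<in> coeff_space \<alpha>"
proof -
  define Z where "Z = {1..sum_list \<alpha>} - {x, y}"
  define e where "e = (\<Sum>z\<in>Z. edge z x - edge z y)"
  have finZ: "finite Z" and xy: "x \<notin> Z" "y \<notin> Z" "x \<noteq> y" "u \<in> Z"
    using oxy by (auto simp: Z_def)
  have S: "i \<in> {1..sum_list \<alpha>} \<longleftrightarrow> i = x \<or> i = y \<or> i \<in> Z" for i
    using oxy by (auto simp: Z_def)
  have xyS: "x \<in> {1..sum_list \<alpha>}" "y \<in> {1..sum_list \<alpha>}"
    using S by blast+
  have origin: "(0, 0) \<in> young_diagram \<alpha>"
    by (rule young_diagram_downward_closed[OF \<alpha> diagram(1)]) auto
  have D: "e + (edge z x - edge z y) \<in> coeff_space \<alpha>" if z: "z \<in> Z" for z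
  proof -
    have "\<exists>t\<in>tableaux \<alpha>. map t [(0, 0), (0, 1), (1, 0)] = [z, x, y]"
      using diagram origin xy z oxy by (intro tableau_with_entries) (auto simp: Z_def)
    then obtain t where t: "t \<in> tableaux \<alpha>" "t (0, 0) = z" "t (0, 1) = x" "t (1, 0) = y"
      by auto
    note rc = tab_row_col_eq[OF t(1)]
    have r: "tab_row \<alpha> t z = 0" "tab_col \<alpha> t z = 0" "tab_row \<alpha> t x = 0" "tab_col \<alpha> t x = 1"
      "tab_row \<alpha> t y = 1" "tab_col \<alpha> t y = 0"
      using rc[OF origin] rc[OF diagram(1)] rc[OF diagram(2)] t by simp_all
    note tc = tabloid_coeff_transpose[OF \<alpha> t(1)]
    let ?k = "transposition_coeffs \<alpha> t"
    have k_val: "?k (i, j) = (if tab_row \<alpha> t i = tab_row \<alpha> t j then 1 else if tab_col \<alpha> t i = tab_col \<alpha> t j then -1 else 0)"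
      if "i = x \<or> i = y \<or> i \<in> Z" "j = x \<or> j = y \<or> j \<in> Z" for i j
      using that[folded S] tc by (simp add: transposition_coeffs_def)
    have k_sym: "?k (i, j) = ?k (j, i)" for i j
      by (simp add: transposition_coeffs_def transpose_commute)
    have k_out: "?k (i, j) = 0" if "\<not> (i = x \<or> i = y \<or> i \<in> Z) \<or> \<not> (j = x \<or> j = y \<or> j \<in> Z)" for i j
      using that[folded S] by (auto simp: transposition_coeffs_def)
    have k_diag: "?k (x, x) = 1" "?k (y, y) = 1"
      by (simp_all add: k_val)
    \<comment> \<open>In a hook, the values of \<open>k\<close> at \<open>(x, j)\<close> and
      \<open>(y, j)\<close> are 1 and -1 for the corner, 1 and 0 for a further arm entry, and 0 and
      -1 for a further leg entry.\<close>
    have k_diff: "?k (x, j) = ?k (y, j) + (if j = z then 2 else 1)" if j: "j \<in> Z" for j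
    proof (cases "j = z")
      case True
      then show ?thesis
        using z by (simp add: k_val r)
    next
      case False
      have jS: "j \<in> {1..sum_list \<alpha>}"
        using j S by blast
      note cell = tab_cell[OF t(1) jS]
      have "tab_row \<alpha> t j = 0 \<or> tab_col \<alpha> t j = 0"
        using young_diagram_downward_closed[OF \<alpha> cell(1), of 1 1] diagram(3) by linarith
      moreover have "(tab_row \<alpha> t j, tab_col \<alpha> t j) \<notin> {(0, 0), (0, 1), (1, 0)}"
      proof
        assume "(tab_row \<alpha> t j, tab_col \<alpha> t j) \<in> {(0, 0), (0, 1), (1, 0)}"
        then have "t (tab_row \<alpha> t j, tab_col \<alpha> t j) \<in> t ` {(0, 0), (0, 1), (1, 0)}"
          by (rule imageI)
        then have "j \<in> {z, x, y}"
          unfolding cell(2) by (simp add: t(2-4)[symmetric])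
        then show False
          using False j xy(1,2) by blast
      qed
      ultimately show ?thesis
        using j False by (auto simp: k_val r)
    qed
    have "e + (edge z x - edge z y) = ?k - transposition_coeffs \<alpha> (transpose x y \<circ> t)"
    proof (rule ext, clarify)
      fix i j
      have e: "(e + (edge z x - edge z y)) (i, j) =
          (if j = x \<and> i \<in> Z then 1 else 0) + (if i = x \<and> j \<in> Z then 1 else 0)
          - ((if j = y \<and> i \<in> Z then 1 else 0) + (if i = y \<and> j \<in> Z then 1 else 0))
          + (edge z x (i, j) - edge z y (i, j))"
        using sum_edge[OF finZ xy(1)] sum_edge[OF finZ xy(2)]
        by (simp add: e_def sum_fun_apply sum_subtractf)
      have ne: "z \<noteq> x" "z \<noteq> y" "x \<noteq> z" "y \<noteq> z" "y \<noteq> x"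
        using z xy by auto
      have "(e + (edge z x - edge z y)) (i, j) = ?k (i, j) - ?k (transpose x y i, transpose x y j)"
      proof -
        consider "i \<in> {x, y}" "j \<in> {x, y}" | "i \<in> {x, y}" "j \<in> Z" | "i \<in> Z" "j \<in> {x, y}"
          | "i \<notin> {x, y}" "j \<notin> {x, y}" | "i \<in> {x, y}" "j \<notin> {x, y}" "j \<notin> Z" | "i \<notin> {x, y}" "i \<notin> Z" "j \<in> {x, y}"
          by blast
        then show ?thesis
        proof cases
          case 1
          then have "i = x \<or> i = y" "j = x \<or> j = y"
            by simp_all
          then show ?thesis
            unfolding e by (elim disjE; simp add: edge_def xy ne k_diag k_sym[of y x])
        next
          case 2
          then have "i = x \<or> i = y" and j: "j \<noteq> x" "j \<noteq> y" "x \<noteq> j" "y \<noteq> j"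
            using xy by auto
          then show ?thesis
            unfolding e by (elim disjE; simp add: edge_def transpose_def xy ne 2(2) j k_diff[OF 2(2)])
        next
          case 3
          then have "j = x \<or> j = y" and i: "i \<noteq> x" "i \<noteq> y" "x \<noteq> i" "y \<noteq> i"
            using xy by auto
          moreover have "?k (i, x) = ?k (i, y) + (if i = z then 2 else 1)"
            using k_diff[OF 3(1)] k_sym[of i x] k_sym[of i y] by simp
          ultimately show ?thesis
            unfolding e by (elim disjE; simp add: edge_def transpose_def xy ne 3(1) i)
        next
          case 4
          then show ?thesis
            unfolding e by (simp add: edge_def transpose_def)
        next
          case 5
          then have "i = x \<or> i = y" and j: "j \<noteq> x" "j \<noteq> y" "x \<noteq> j" "y \<noteq> j" "j \<noteq> z"
            using z by auto
          then show ?thesis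
            unfolding e by (elim disjE; simp add: edge_def transpose_def xy ne 5(3) j k_out)
        next
          case 6
          then have "j = x \<or> j = y" and i: "i \<noteq> x" "i \<noteq> y" "x \<noteq> i" "y \<noteq> i" "i \<noteq> z"
            using z by auto
          then show ?thesis
            unfolding e by (elim disjE; simp add: edge_def transpose_def xy ne 6(2) i k_out)
        qed
      qed
      then show "(e + (edge z x - edge z y)) (i, j) = (?k - transposition_coeffs \<alpha> (transpose x y \<circ> t)) (i, j)"
        by (simp only: minus_apply transposition_coeffs_transpose[OF \<alpha> t(1) xyS])
    qed
    also have "\<dots> \<in> coeff_space \<alpha>"
      by (intro coeff_space_diff transposition_coeffs_in_coeff_space comp_tableaux permutes_swap_id t(1) xyS)
    finally show ?thesis .
  qed
  \<comment> \<open>The terms \<open>edge z x - edge z y\<close> add up to \<open>e\<close> once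
    more, which accounts for the \<open>+ 1\<close>.\<close>
  have "cfun_scale (of_nat (card Z + 1)) e = (\<Sum>z\<in>Z. e) + e"
    by (rule ext) (simp add: cfun_scale_def sum_fun_apply algebra_simps)
  also have "\<dots> = (\<Sum>z\<in>Z. e + (edge z x - edge z y))"
    unfolding sum.distrib by (simp only: e_def)
  also have "\<dots> \<in> coeff_space \<alpha>"
    by (intro coeff_space_sum D)
  finally have "e \<in> coeff_space \<alpha>"
    by (rule coeff_space_cancel_scale) (simp only: of_nat_eq_0_iff)
  then have "e + (edge u x - edge u y) - e \<in> coeff_space \<alpha>"
    by (intro coeff_space_diff D xy(4))
  then show ?thesis
    by simp
qed

section \<open>The commutator form on pairs of coefficient functions\<close>

definition commutator_coeff :: "nat list \<Rightarrow> (nat \<times> nat \<Rightarrow> nat) \<Rightarrow> nat \<Rightarrow> nat \<Rightarrow> nat \<Rightarrow> nat \<Rightarrow> complex"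
  where "commutator_coeff \<alpha> t a b c d =
    tabloid_coeff \<alpha> t (transpose a b \<circ> transpose c d) - tabloid_coeff \<alpha> t (transpose c d \<circ> transpose a b)"

text \<open>The tabloid coefficient of the commutator of two group algebra elements, namely the
  combinations of transpositions over ordered pairs with weights \<open>f\<close> and
  \<open>g\<close>.\<close>

definition commutator_form ::
    "nat list \<Rightarrow> (nat \<times> nat \<Rightarrow> nat) \<Rightarrow> (nat \<times> nat \<Rightarrow> complex) \<Rightarrow> (nat \<times> nat \<Rightarrow> complex) \<Rightarrow> complex"
  where "commutator_form \<alpha> t f g =
    (\<Sum>(i, j)\<in>{1..sum_list \<alpha>} \<times> {1..sum_list \<alpha>}. \<Sum>(k, l)\<in>{1..sum_list \<alpha>} \<times> {1..sum_list \<alpha>}.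
      f (i, j) * g (k, l) * commutator_coeff \<alpha> t i j k l)"

lemma commutator_form_linear:
  "commutator_form \<alpha> t (f + f') g = commutator_form \<alpha> t f g + commutator_form \<alpha> t f' g"
  "commutator_form \<alpha> t (f - f') g = commutator_form \<alpha> t f g - commutator_form \<alpha> t f' g"
  "commutator_form \<alpha> t (cfun_scale c f) g = c * commutator_form \<alpha> t f g"
  "commutator_form \<alpha> t f (g + g') = commutator_form \<alpha> t f g + commutator_form \<alpha> t f g'"
  "commutator_form \<alpha> t f (g - g') = commutator_form \<alpha> t f g - commutator_form \<alpha> t f g'"
  "commutator_form \<alpha> t f (cfun_scale c g) = c * commutator_form \<alpha> t f g"
  unfolding commutator_form_def case_prod_unfold
  by (simp_all add: cfun_scale_def sum.distrib sum_subtractf sum_distrib_left algebra_simps)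

lemma commutator_form_zero: "commutator_form \<alpha> t 0 g = 0" "commutator_form \<alpha> t f 0 = 0"
  by (simp_all add: commutator_form_def case_prod_unfold)

text \<open>For generators of the two coefficient spaces this is the identity for transposition
  coefficients; bilinearity extends it to the spans, one argument at a time.\<close>

lemma commutator_form_eq_zero:
  assumes n: "sum_list \<alpha> = n" "sum_list \<beta> = n" "sum_list \<gamma> = n"
    and mf: "multiplicity_free (sym_group n) (\<lambda>g. sym_character \<alpha> g * sym_character \<beta> g * sym_character \<gamma> g)"
    and t: "t \<in> tableaux \<alpha>" and f: "f \<in> coeff_space \<beta>" and g: "g \<in> coeff_space \<gamma>"
  shows "commutator_form \<alpha> t f g = 0"
proof -
  have gen: "commutator_form \<alpha> t (transposition_coeffs \<beta> s) (transposition_coeffs \<gamma> r) = 0"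
    if "s \<in> tableaux \<beta>" "r \<in> tableaux \<gamma>" for s r
  proof -
    have "commutator_form \<alpha> t (transposition_coeffs \<beta> s) (transposition_coeffs \<gamma> r) =
      (\<Sum>(i, j)\<in>{1..n} \<times> {1..n}. \<Sum>(k, l)\<in>{1..n} \<times> {1..n}.
        tabloid_coeff \<beta> s (transpose i j) * tabloid_coeff \<gamma> r (transpose k l) *
        (tabloid_coeff \<alpha> t (transpose i j \<circ> transpose k l) - tabloid_coeff \<alpha> t (transpose k l \<circ> transpose i j)))"
      unfolding commutator_form_def n transposition_coeffs_def commutator_coeff_def case_prod_unfold
      by (intro sum.cong refl) auto
    then show ?thesis
      using transposition_coeff_identity[OF n mf t that] by simp
  qed
  have gen': "commutator_form \<alpha> t (transposition_coeffs \<beta> s) g = 0" if "s \<in> tableaux \<beta>" for s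
    using g unfolding coeff_space_def
  proof (induction rule: cfun.span_induct)
    case base
    show ?case
      by (simp only: cfun.subspace_def mem_Collect_eq commutator_form_linear commutator_form_zero) simp
  next
    case (step x)
    then show ?case
      using gen that by blast
  qed
  show ?thesis
    using f unfolding coeff_space_def
  proof (induction rule: cfun.span_induct)
    case base
    show ?case
      by (simp only: cfun.subspace_def mem_Collect_eq commutator_form_linear commutator_form_zero) simp
  next
    case (step x)
    then show ?case
      using gen' by blast
  qed
qed

lemma commutator_coeff_commute:
  "commutator_coeff \<alpha> t b a c d = commutator_coeff \<alpha> t a b c d"
  "commutator_coeff \<alpha> t a b d c = commutator_coeff \<alpha> t a b c d"
  by (simp_all add: commutator_coeff_def transpose_commute)

lemma commutator_coeff_same: "commutator_coeff \<alpha> t a b a b = 0"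
  by (simp add: commutator_coeff_def)

lemma commutator_coeff_disjoint:
  assumes "distinct [a, b, c, d]"
  shows "commutator_coeff \<alpha> t a b c d = 0"
proof -
  have "transpose a b \<circ> transpose c d = transpose c d \<circ> transpose a b"
    using assms by (auto simp: fun_eq_iff transpose_def)
  then show ?thesis
    by (simp add: commutator_coeff_def)
qed

text \<open>The factor 4 comes from the two orderings of each of the two edges.\<close>

lemma commutator_form_edge:
  assumes "a \<noteq> b" "c \<noteq> d" and S: "{a, b, c, d} \<subseteq> {1..sum_list \<alpha>}"
  shows "commutator_form \<alpha> t (edge a b) (edge c d) = 4 * commutator_coeff \<alpha> t a b c d"
proof -
  let ?S = "{1..sum_list \<alpha>}"
  have edge_sum: "(\<Sum>(i, j)\<in>?S \<times> ?S. edge a b (i, j) * h i j) = h a b + h b a"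
    if "a \<noteq> b" "{a, b} \<subseteq> ?S" for a b and h :: "nat \<Rightarrow> nat \<Rightarrow> complex"
  proof -
    have "(\<Sum>(i, j)\<in>?S \<times> ?S. edge a b (i, j) * h i j) = (\<Sum>(i, j)\<in>{(a, b), (b, a)}. edge a b (i, j) * h i j)"
      using that by (intro sum.mono_neutral_right) (auto simp: edge_def split: if_splits)
    then show ?thesis
      using that(1) by (simp add: edge_def)
  qed
  have "commutator_form \<alpha> t (edge a b) (edge c d) = (\<Sum>(i, j)\<in>?S \<times> ?S. edge a b (i, j) *
      (\<Sum>(k, l)\<in>?S \<times> ?S. edge c d (k, l) * commutator_coeff \<alpha> t i j k l))"
    unfolding commutator_form_def by (intro sum.cong) (auto simp: sum_distrib_left case_prod_unfold mult.assoc)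
  also have "\<dots> = (\<Sum>(i, j)\<in>?S \<times> ?S. edge a b (i, j) * (commutator_coeff \<alpha> t i j c d + commutator_coeff \<alpha> t i j d c))"
    using assms by (subst edge_sum) auto
  also have "\<dots> = 4 * commutator_coeff \<alpha> t a b c d"
    using assms by (subst edge_sum) (auto simp: commutator_coeff_commute[of \<alpha> t b a] commutator_coeff_commute(2)[of \<alpha> t _ _ d c])
  finally show ?thesis .
qed

text \<open>The product of two transpositions among \<open>u\<close>, \<open>x\<close>, \<open>y\<close> is one of the two \<open>3\<close>-cycles:
  one maps \<open>u\<close> and \<open>y\<close>, which share a column, into the same row and has coefficient \<open>0\<close>; the other
  agrees on tabloids with \<open>(u y)\<close> and has coefficient \<open>-1\<close>.\<close>

lemma commutator_coeff_corner:
  assumes t: "t \<in> tableaux \<alpha>" and uxy: "distinct [u, x, y]" "{u, x, y} \<subseteq> {1..sum_list \<alpha>}"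
    and row: "tab_row \<alpha> t u = tab_row \<alpha> t x" and col: "tab_col \<alpha> t u = tab_col \<alpha> t y"
  shows "commutator_coeff \<alpha> t u x u y = -1" "commutator_coeff \<alpha> t u y x y = -1" "commutator_coeff \<alpha> t x y u x = -1"
    "commutator_coeff \<alpha> t u y u x = 1" "commutator_coeff \<alpha> t x y u y = 1" "commutator_coeff \<alpha> t u x x y = 1"
proof -
  have S: "u \<in> {1..sum_list \<alpha>}" "x \<in> {1..sum_list \<alpha>}" "y \<in> {1..sum_list \<alpha>}"
    using uxy(2) by blast+
  note p = permutes_swap_id[OF S(1,2)] permutes_swap_id[OF S(1,3)] permutes_swap_id[OF S(2,3)]
  define g where "g = transpose u x \<circ> transpose x y"
  define h where "h = transpose x y \<circ> transpose u x"
  have gp: "g permutes {1..sum_list \<alpha>}" and hp: "h permutes {1..sum_list \<alpha>}"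
    unfolding g_def h_def by (intro permutes_compose p)+
  have gs: "transpose u y \<circ> transpose u x = g" "transpose x y \<circ> transpose u y = g"
    and hs: "transpose u x \<circ> transpose u y = h" "transpose u y \<circ> transpose x y = h"
    using uxy(1) by (auto simp: fun_eq_iff transpose_def g_def h_def)
  have "tabloid_coeff \<alpha> t g = 0"
    using uxy(1) row col by (intro tabloid_coeff_eq_zero[OF t gp S(1,3)]) (auto simp: g_def transpose_def)
  moreover have "tabloid_coeff \<alpha> t h = of_int (sign (transpose u y))"
    using uxy(1) row col by (intro tabloid_coeff_eq_sign[OF t hp p(2)]) (auto simp: h_def transpose_def)
  then have "tabloid_coeff \<alpha> t h = -1"
    using uxy(1) by (simp add: sign_swap_id)
  ultimately show "commutator_coeff \<alpha> t u x u y = -1" "commutator_coeff \<alpha> t u y x y = -1" "commutator_coeff \<alpha> t x y u x = -1"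
    "commutator_coeff \<alpha> t u y u x = 1" "commutator_coeff \<alpha> t x y u y = 1" "commutator_coeff \<alpha> t u x x y = 1"
    unfolding commutator_coeff_def gs hs g_def[symmetric] h_def[symmetric] by simp_all
qed

text \<open>The first cycle is the rows minus the diagonals of the block, the second the columns
  minus the diagonals. Any three of the four entries form a corner in one of four orientations, so
  the corner values settle all commutators of edges sharing one entry.\<close>

lemma commutator_form_block:
  assumes t: "t \<in> tableaux \<alpha>" and pquv: "distinct [p, q, u, v]" "{p, q, u, v} \<subseteq> {1..sum_list \<alpha>}"
    and row: "tab_row \<alpha> t p = tab_row \<alpha> t q" "tab_row \<alpha> t u = tab_row \<alpha> t v"
    and col: "tab_col \<alpha> t p = tab_col \<alpha> t u" "tab_col \<alpha> t q = tab_col \<alpha> t v"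
  shows "commutator_form \<alpha> t (four_cycle p q u v) (four_cycle p u q v) \<noteq> 0"
proof -
  have d: "distinct [p, q, u]" "distinct [q, p, v]" "distinct [u, v, p]" "distinct [v, u, q]"
    "distinct [q, u, v, p]" "distinct [v, p, u, q]"
    using pquv(1) by auto
  have sub: "{p, q, u} \<subseteq> {1..sum_list \<alpha>}" "{q, p, v} \<subseteq> {1..sum_list \<alpha>}"
    "{u, v, p} \<subseteq> {1..sum_list \<alpha>}" "{v, u, q} \<subseteq> {1..sum_list \<alpha>}"
    using pquv(2) by blast+
  note corners = commutator_coeff_corner[OF t d(1) sub(1) row(1) col(1)]
    commutator_coeff_corner[OF t d(2) sub(2) row(1)[symmetric] col(2)]
    commutator_coeff_corner[OF t d(3) sub(3) row(2) col(1)[symmetric]]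
    commutator_coeff_corner[OF t d(4) sub(4) row(2)[symmetric] col(2)[symmetric]]
    commutator_coeff_disjoint[OF d(5), of \<alpha> t] commutator_coeff_disjoint[OF d(6), of \<alpha> t]
  have ne: "p \<noteq> q" "p \<noteq> u" "p \<noteq> v" "q \<noteq> u" "q \<noteq> v" "u \<noteq> v"
    using pquv(1) by auto
  have edges: "commutator_form \<alpha> t (edge a b) (edge c d) = 4 * commutator_coeff \<alpha> t a b c d"
    if "a \<noteq> b" "c \<noteq> d" "a \<in> {p, q, u, v}" "b \<in> {p, q, u, v}" "c \<in> {p, q, u, v}" "d \<in> {p, q, u, v}" for a b c d
    using that pquv(2) by (intro commutator_form_edge) auto
  \<comment> \<open>Of the sixteen products of edges, twelve share exactly one entry and contribute
    -4 each with their signs; in the other four the edges coincide or are disjoint.\<close>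
  have "commutator_form \<alpha> t (four_cycle p q u v) (four_cycle p u q v) = -48"
    unfolding four_cycle_def commutator_form_linear using corners
    by (simp add: edges ne ne[symmetric] commutator_coeff_commute commutator_coeff_same)
  then show ?thesis
    by simp
qed

lemma commutator_form_corner:
  assumes t: "t \<in> tableaux \<alpha>" and uxy: "distinct [u, x, y]" "{u, x, y} \<subseteq> {1..sum_list \<alpha>}"
    and row: "tab_row \<alpha> t u = tab_row \<alpha> t x" and col: "tab_col \<alpha> t u = tab_col \<alpha> t y"
  shows "commutator_form \<alpha> t (edge u x - edge u y) (edge x u - edge x y) \<noteq> 0"
proof -
  have "commutator_form \<alpha> t (edge u x - edge u y) (edge u x - edge x y) =
      4 * (commutator_coeff \<alpha> t u x u x - commutator_coeff \<alpha> t u y u x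
        - (commutator_coeff \<alpha> t u x x y - commutator_coeff \<alpha> t u y x y))"
    using uxy by (simp add: commutator_form_linear commutator_form_edge)
  \<comment> \<open>Three of the four commutators are nonzero; with their coefficients they
    contribute -1, -1 and -1 inside the bracket.\<close>
  also have "\<dots> = -12"
    by (simp add: commutator_coeff_same commutator_coeff_corner[OF t uxy row col])
  finally show ?thesis
    by (simp add: edge_commute[of x u])
qed

section \<open>Cells of diagrams and the case distinction\<close>

lemma partition_diagram:
  assumes part: "partition_of n \<alpha>" and ne: "\<alpha> \<noteq> [n]" "\<alpha> \<noteq> replicate n 1"
  shows "(0, 1) \<in> young_diagram \<alpha>" "(1, 0) \<in> young_diagram \<alpha>"
proof -
  have sorted: "sorted_wrt (\<ge>) \<alpha>" and pos: "\<And>k. k \<in> set \<alpha> \<Longrightarrow> k > 0" and sum: "sum_list \<alpha> = n"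
    using part by (auto simp: partition_of_def)
  \<comment> \<open>For \<open>n = 0\<close> the empty list equals \<open>replicate 0 1\<close>, so
    the degenerate partition is excluded by \<open>ne(2)\<close>.\<close>
  have "\<alpha> \<noteq> []"
    using ne(2) sum by auto
  have "length \<alpha> \<noteq> 1"
  proof
    assume "length \<alpha> = 1"
    then obtain a where "\<alpha> = [a]"
      by (auto simp: length_Suc_conv)
    then show False
      using ne(1) sum by simp
  qed
  then have len: "length \<alpha> > 1"
    using \<open>\<alpha> \<noteq> []\<close> by (cases "length \<alpha>") auto
  then show "(1, 0) \<in> young_diagram \<alpha>"
    using pos by (simp add: young_diagram_def)
  have "\<not> \<alpha> ! 0 \<le> 1"
  proof
    assume "\<alpha> ! 0 \<le> 1"
    have "k = 1" if k: "k \<in> set \<alpha>" for k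
    proof -
      obtain i where i: "i < length \<alpha>" "\<alpha> ! i = k"
        using k by (auto simp: in_set_conv_nth)
      have "k \<le> \<alpha> ! 0"
        using sorted_wrt_nth_less[OF sorted, of 0 i] i by (cases "i = 0") auto
      then show "k = 1"
        using pos[OF k] \<open>\<alpha> ! 0 \<le> 1\<close> by linarith
    qed
    then have "\<alpha> = replicate (length \<alpha>) 1"
      by (intro replicate_eqI) auto
    then obtain m where m: "\<alpha> = replicate m 1"
      by (rule that)
    then have "m = n"
      using sum by (simp add: sum_list_replicate)
    then show False
      using ne(2) m by simp
  qed
  then show "(0, 1) \<in> young_diagram \<alpha>"
    using len by (auto simp: young_diagram_def)
qed

text \<open>A downward closed set of cells avoiding all three cells with coordinate sum two lies
  within the corner and its two neighbours, which are only three cells.\<close>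

lemma fourth_cell_of_diagram:
  assumes \<alpha>: "sorted_wrt (\<ge>) \<alpha>" and n: "sum_list \<alpha> \<ge> 4"
  shows "\<exists>z\<in>young_diagram \<alpha>. z \<in> {(1, 1), (0, 2), (2, 0)}"
proof (rule ccontr)
  assume none: "\<not> (\<exists>z\<in>young_diagram \<alpha>. z \<in> {(1, 1), (0, 2), (2, 0)})"
  note closed = young_diagram_downward_closed[OF \<alpha>]
  have "(i, j) \<in> {(0, 0), (0, 1), (1, 0)}" if ij: "(i, j) \<in> young_diagram \<alpha>" for i j
  proof -
    have "\<not> (1 \<le> i \<and> 1 \<le> j)" "\<not> 2 \<le> i" "\<not> 2 \<le> j"
      using closed[OF ij, of 1 1] closed[OF ij, of 2 0] closed[OF ij, of 0 2] none by auto
    then show ?thesis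
      by auto
  qed
  then have "young_diagram \<alpha> \<subseteq> {(0, 0), (0, 1), (1, 0)}"
    by auto
  then have "card (young_diagram \<alpha>) \<le> card {(0::nat, 0::nat), (0, 1), (1, 0)}"
    by (intro card_mono) auto
  then show False
    using n by (simp add: card_young_diagram)
qed

text \<open>The block in \<alpha> makes the commutator form nonzero on two alternating cycles
  through its entries, while \<beta> and \<gamma> supply exactly such cycles.\<close>

lemma not_multiplicity_free_if_block:
  assumes part: "partition_of n \<alpha>" "partition_of n \<beta>" "partition_of n \<gamma>"
    and ne: "\<beta> \<noteq> [n]" "\<beta> \<noteq> replicate n 1" "\<gamma> \<noteq> [n]" "\<gamma> \<noteq> replicate n 1"
    and block: "(1, 1) \<in> young_diagram \<alpha>"
  shows "\<not> multiplicity_free (sym_group n)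
    (\<lambda>g. sym_character \<alpha> g * sym_character \<beta> g * sym_character \<gamma> g)"
proof
  assume mf: "multiplicity_free (sym_group n)
    (\<lambda>g. sym_character \<alpha> g * sym_character \<beta> g * sym_character \<gamma> g)"
  have sorted: "sorted_wrt (\<ge>) \<alpha>" "sorted_wrt (\<ge>) \<beta>" "sorted_wrt (\<ge>) \<gamma>"
    and sum: "sum_list \<alpha> = n" "sum_list \<beta> = n" "sum_list \<gamma> = n"
    using part by (auto simp: partition_of_def)
  obtain t where t: "t \<in> tableaux \<alpha>"
    using tableau_with_entries[of "[]" "[]" \<alpha>] by auto
  have cells: "(0, 0) \<in> young_diagram \<alpha>" "(0, 1) \<in> young_diagram \<alpha>" "(1, 0) \<in> young_diagram \<alpha>"
    by (rule young_diagram_downward_closed[OF sorted(1) block]; simp)+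
  let ?p = "t (0, 0)" and ?q = "t (0, 1)" and ?u = "t (1, 0)" and ?v = "t (1, 1)"
  have inj: "inj_on t (young_diagram \<alpha>)"
    using t by (auto simp: tableaux_def bij_betw_def)
  have distinct: "distinct [?p, ?q, ?u, ?v]"
    using cells block inj_on_eq_iff[OF inj] by auto
  have sub: "{?p, ?q, ?u, ?v} \<subseteq> {1..sum_list \<alpha>}"
    using tableau_in_range[OF t] cells block by blast
  \<comment> \<open>The four entries of the block force \<open>n \<ge> 4\<close>, which gives the
    diagrams of \<beta> and \<gamma> the fourth cell required for alternating cycles.\<close>
  have "4 = card {?p, ?q, ?u, ?v}"
    using distinct by simp
  also have "\<dots> \<le> card {1..sum_list \<alpha>}"
    by (rule card_mono[OF _ sub]) simp
  finally have n4: "n \<ge> 4"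
    using sum by simp
  have four: "four_cycle a b c d \<in> coeff_space \<delta>"
    if "partition_of n \<delta>" "\<delta> \<noteq> [n]" "\<delta> \<noteq> replicate n 1" "distinct [a, b, c, d]" "{a, b, c, d} \<subseteq> {1..n}"
    for \<delta> a b c d
  proof -
    have \<delta>: "sorted_wrt (\<ge>) \<delta>" "sum_list \<delta> = n"
      using that(1) by (auto simp: partition_of_def)
    obtain z where "z \<in> young_diagram \<delta>" "z \<in> {(1, 1), (0, 2), (2, 0)}"
      using fourth_cell_of_diagram[OF \<delta>(1)] \<delta>(2) n4 by auto
    then show ?thesis
      using four_cycle_in_coeff_space[OF \<delta>(1) that(4) _ partition_diagram[OF that(1-3)]] that(5) \<delta>(2) by simp
  qed
  have "commutator_form \<alpha> t (four_cycle ?p ?q ?u ?v) (four_cycle ?p ?u ?q ?v) = 0"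
    using distinct sub sum
    by (intro commutator_form_eq_zero[OF sum mf t] four part ne) auto
  moreover note rc = tab_row_col_eq[OF t]
  have "commutator_form \<alpha> t (four_cycle ?p ?q ?u ?v) (four_cycle ?p ?u ?q ?v) \<noteq> 0"
    by (rule commutator_form_block[OF t distinct sub]) (simp_all add: rc cells[simplified] block[simplified])
  ultimately show False
    by simp
qed

text \<open>The hooks \<beta> and \<gamma> supply differences of edges at a common entry, and the
  three cells at the corner of \<alpha> detect that two of these do not commute. This includes
  \<open>n = 3\<close>, where alternating 4-cycles do not exist.\<close>

lemma not_multiplicity_free_if_hooks:
  assumes part: "partition_of n \<alpha>" "partition_of n \<beta>" "partition_of n \<gamma>"
    and ne: "\<alpha> \<noteq> [n]" "\<alpha> \<noteq> replicate n 1" "\<beta> \<noteq> [n]" "\<beta> \<noteq> replicate n 1"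
      "\<gamma> \<noteq> [n]" "\<gamma> \<noteq> replicate n 1"
    and hook: "(1, 1) \<notin> young_diagram \<beta>" "(1, 1) \<notin> young_diagram \<gamma>"
  shows "\<not> multiplicity_free (sym_group n)
    (\<lambda>g. sym_character \<alpha> g * sym_character \<beta> g * sym_character \<gamma> g)"
proof
  assume mf: "multiplicity_free (sym_group n)
    (\<lambda>g. sym_character \<alpha> g * sym_character \<beta> g * sym_character \<gamma> g)"
  have sorted: "sorted_wrt (\<ge>) \<alpha>" "sorted_wrt (\<ge>) \<beta>" "sorted_wrt (\<ge>) \<gamma>"
    and sum: "sum_list \<alpha> = n" "sum_list \<beta> = n" "sum_list \<gamma> = n"
    using part by (auto simp: partition_of_def)
  obtain t where t: "t \<in> tableaux \<alpha>"
    using tableau_with_entries[of "[]" "[]" \<alpha>] by auto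
  note cells = partition_diagram[OF part(1) ne(1,2)]
  have origin: "(0, 0) \<in> young_diagram \<alpha>"
    by (rule young_diagram_downward_closed[OF sorted(1) cells(1)]) simp_all
  let ?u = "t (0, 0)" and ?x = "t (0, 1)" and ?y = "t (1, 0)"
  have inj: "inj_on t (young_diagram \<alpha>)"
    using t by (auto simp: tableaux_def bij_betw_def)
  have distinct: "distinct [?u, ?x, ?y]"
    using cells origin inj_on_eq_iff[OF inj] by auto
  have sub: "{?u, ?x, ?y} \<subseteq> {1..sum_list \<alpha>}"
    using tableau_in_range[OF t] cells origin by blast
  have "commutator_form \<alpha> t (edge ?u ?x - edge ?u ?y) (edge ?x ?u - edge ?x ?y) = 0"
    using distinct sub sum
    by (intro commutator_form_eq_zero[OF sum mf t] edge_diff_in_coeff_space_if_hook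
        sorted partition_diagram[OF part(2) ne(3,4)] partition_diagram[OF part(3) ne(5,6)] hook) auto
  moreover note rc = tab_row_col_eq[OF t]
  have "commutator_form \<alpha> t (edge ?u ?x - edge ?u ?y) (edge ?x ?u - edge ?x ?y) \<noteq> 0"
    by (rule commutator_form_corner[OF t distinct sub]) (simp_all add: rc cells[simplified] origin)
  ultimately show False
    by simp
qed

theorem theorem1p2:
  fixes n :: nat and lam \<mu> \<nu> :: "nat list"
  assumes "partition_of n lam" and "partition_of n \<mu>" and "partition_of n \<nu>"
    and "lam \<noteq> [n]" and "lam \<noteq> replicate n 1"
    and "\<mu> \<noteq> [n]" and "\<mu> \<noteq> replicate n 1"
    and "\<nu> \<noteq> [n]" and "\<nu> \<noteq> replicate n 1"
  shows "\<not> multiplicity_free (sym_group n)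
    (\<lambda>g. sym_character lam g * sym_character \<mu> g * sym_character \<nu> g)"
proof -
  note lam = assms(1,4,5) and \<mu> = assms(2,6,7) and \<nu> = assms(3,8,9)
  \<comment> \<open>A factor containing the block is moved to the first place by commutativity of
    the product. In the last case hooks \<mu> and \<nu> suffice, whatever the shape of
    \<open>lam\<close>.\<close>
  consider "(1, 1) \<in> young_diagram lam" | "(1, 1) \<in> young_diagram \<mu>" | "(1, 1) \<in> young_diagram \<nu>"
    | "(1, 1) \<notin> young_diagram \<mu>" "(1, 1) \<notin> young_diagram \<nu>"
    by blast
  then show ?thesis
  proof cases
    case 1
    then show ?thesis
      by (rule not_multiplicity_free_if_block[OF lam(1) \<mu>(1) \<nu>(1) \<mu>(2,3) \<nu>(2,3)])
  next
    case 2
    have eq: "(\<lambda>g. sym_character lam g * sym_character \<mu> g * sym_character \<nu> g) =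
        (\<lambda>g. sym_character \<mu> g * sym_character lam g * sym_character \<nu> g)"
      by (simp add: mult_ac)
    show ?thesis
      unfolding eq by (rule not_multiplicity_free_if_block[OF \<mu>(1) lam(1) \<nu>(1) lam(2,3) \<nu>(2,3) 2])
  next
    case 3
    have eq: "(\<lambda>g. sym_character lam g * sym_character \<mu> g * sym_character \<nu> g) =
        (\<lambda>g. sym_character \<nu> g * sym_character lam g * sym_character \<mu> g)"
      by (simp add: mult_ac)
    show ?thesis
      unfolding eq by (rule not_multiplicity_free_if_block[OF \<nu>(1) lam(1) \<mu>(1) lam(2,3) \<mu>(2,3) 3])
  next
    case 4
    then show ?thesis
      by (rule not_multiplicity_free_if_hooks[OF lam(1) \<mu>(1) \<nu>(1) lam(2,3) \<mu>(2,3) \<nu>(2,3)])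
  qed
qed

end
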